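(* Let the units be the individual data sources, let the sources be independent, let $\Psi=\Psi_{l,u}$ with $l\ge1$, and let $s'_k=[K]$ for every $k\in[K]$. (i) If $l=u<K$, then $T^*=\inf\{n\in\mathbb N:\Lambda_{(u)}(n)\ge\Lambda_{(u+1)}(n)\max\{A,B\}\}$. (ii) If $l<u\le K$, then $T^*=T_1\wedge T_2\wedge T_4\wedge T_5\wedge T_6$ when $u<K$ and $T^*=T_1\wedge T_2\wedge T_3$ when $u=K$, where \begin{align*} T_1&=\inf\{n:p(n)<l\text{ and }\Lambda_{(l)}(n)\ge\Lambda_{(l+1)}(n)\max\{A,B\}\},\\ T_2&=\inf\{n:p(n)=l\text{ and }\Lambda_{(l+1)}(n)\le\min\{1/A,\Lambda_{(l)}(n)/B\}\},\\ T_3&=\inf\{n:p(n)>l\text{ and }\Lambda_k(n)\notin(1/A,B)\ \forall k\in[K]\},\\ T_4&=\inf\{n:p(n)\in(l,u)\text{ and }\Lambda_k(n)\notin(1/A,B)\ \forall k\in[K]\},\\ T_5&=\inf\{n:p(n)=u\text{ and }\Lambda_{(u)}(n)\ge\max\{B,A\Lambda_{(u+1)}(n)\}\},\\ T_6&=\inf\{n:p(n)>u\text{ and }\Lambda_{(u)}(n)\ge\Lambda_{(u+1)}(n)\max\{A,B\}\}. \end{align*}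
   Context: Setting. $K$ data sources, $[K]=\{1,\dots,K\}$; $X_n^k$ is the observation of source $k$ at time $n\in\mathbb N$; for $s\subseteq[K]$, $X_n^s=\{X_n^k:k\in s\}$, $X^s=\{X^s_n\}_{n}$, $\mathcal F_n^s=\sigma(X_1^s,\dots,X_n^s)$ (superscript omitted for $s=[K]$, written $k$ for $s=\{k\}$). $\mathcal P$ is a finite family of distributions of $X$, $\mathsf P^s$ the law of $X^s$ under $\mathsf P$, $\mathcal Q^s=\{\mathsf P^s:\mathsf P\in\mathcal Q\}$. The units are the singletons $\{k\}$, $k\in[K]$ (identified with $k$). For each $k$, $\mathcal H^k,\mathcal G^k$ are nonempty disjoint subfamilies of $\mathcal P^k$; $\mathcal A(\mathsf P)=\{k:\mathsf P^k\in\mathcal G^k\}$. $\Psi=\Psi_{l,u}=\{A\subseteq[K]:l\le|A|\le u\}$. $\mathcal P_\Psi=\{\mathsf P\in\mathcal P:\mathsf P^k\in\mathcal H^k\cup\mathcal G^k\ \forall k,\ \mathcal A(\mathsf P)\in\Psi\}$, $\mathcal H_0=\{\mathsf P\in\mathcal P:\mathsf P^k\in\mathcal H^k\ \forall k\}$, $\mathcal H_{\Psi,k}=\{\mathsf P\in\mathcal P_\Psi\setminus\mathcal H_0:k\notin\mathcal A(\mathsf P)\}$, $\mathcal G_{\Psi,k}=\{\mathsf P\in\mathcal P_\Psi:k\in\mathcal A(\mathsf P)\}$. Independence: $\mathsf P=\mathsf P^1\otimes\cdots\otimes\mathsf P^K$ for every $\mathsf P\in\mathcal P_\Psi$. Standing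 assumptions: for $\mathsf P\in\mathcal G_{\Psi,k}\cup\mathcal H_0$, $\mathsf Q\in\mathcal H_{\Psi,k}\cup\mathcal H_0$, $k\in s\subseteq[K]$, $n\in\mathbb N$, $\mathsf P^s,\mathsf Q^s$ are mutually absolutely continuous on $\mathcal F_n^s$; $\Lambda_n(\mathsf P^s,\mathsf Q^s)=\frac{d\mathsf P^s}{d\mathsf Q^s}(\mathcal F_n^s)$, $Z_n=\log\Lambda_n$. Moreover, for every $k\in[K]$, $\mathsf P\in\mathcal G_{\Psi,k}$, $\mathsf Q\in\mathcal H_{\Psi,k}\cup\mathcal H_0$, $k\in s\subseteq[K]$ there are positive numbers $\mathcal I(\mathsf P^s,\mathsf Q^s)$, $\mathcal I(\mathsf Q^s,\mathsf P^s)$ such that, as $n\to\infty$, $\mathsf P(\max_{1\le m\le n}Z_m(\mathsf P^s,\mathsf Q^s)\ge n\rho)\to0$ for all $\rho>\mathcal I(\mathsf P^s,\mathsf Q^s)$, $\mathsf Q(\max_{1\le m\le n}Z_m(\mathsf Q^s,\mathsf P^s)\ge n\rho)\to0$ for all $\rho>\mathcal I(\mathsf Q^s,\mathsf P^s)$, and $\sum_n\mathsf P(Z_n(\mathsf P^s,\mathsf Q^s)<n\rho)<\infty$ for all $\rho<\mathcal I(\mathsf P^s,\mathsf Q^s)$, $\sum_n\mathsf Q(Z_n(\mathsf Q^s,\mathsf P^s)<n\rho)<\infty$ for all $\rho<\mathcal I(\mathsf Q^s,\mathsf P^s)$. $s'_k$ is the isolation subsystem of unit $k$ (the set of sources whose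 data are used in its isolation statistic). With $s'_k=[K]$ the isolation statistic is $$\Lambda_{k,\rm iso}(n)=\frac{\max\{\Lambda_n(\mathsf P,\mathsf P_0'):\mathsf P\in\mathcal G_{\Psi,k}\}}{\max\{\Lambda_n(\mathsf P,\mathsf P_0'):\mathsf P\in\mathcal H_{\Psi,k}\}},\quad\mathsf P_0'\in\mathcal H_0\text{ arbitrary},$$ and $D_{\rm iso}(n)=\{k:\Lambda_{k,\rm iso}(n)>1\}$. The local statistics are $\Lambda_k(n)=\max\{\Lambda_n(\mathsf P,\mathsf P_0):\mathsf P\in\mathcal G^k\}/\max\{\Lambda_n(\mathsf P,\mathsf P_0):\mathsf P\in\mathcal H^k\}$, $\mathsf P_0\in\mathcal H_0^k$ arbitrary; $\Lambda_{(1)}(n)\ge\dots\ge\Lambda_{(K)}(n)$ are their ordered values and $p(n)=|\{k:\Lambda_k(n)>1\}|$. Stopping time of the pure isolation test with common thresholds $A,B>1$: $T^*=\inf\{n\in\mathbb N:D_{\rm iso}(n)\in\Psi,\ \Lambda_{k,\rm iso}(n)\notin(1/A,B)\ \forall k\in[K]\}$.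
   Formalization: Adds the assumption, without which the claim fails, that every choice of local laws from the sets H^k and G^k whose set of signals lies in Ψ is realized by some law in the family; the equalities of stopping times are almost sure under every law in P_Ψ and H_0. *)

theory Defs
  imports "HOL-Probability.Probability" "HOL-Library.Extended_Nat"
begin

section \<open>Observations of a subsystem of sources\<close>

text \<open>
  The canonical model is used: a path \<open>x\<close> records the observation \<open>x k n\<close> of source \<open>k\<close> at
  time \<open>n \<ge> 1\<close>, which takes values in the measurable space \<open>S k n\<close>, and a law of \<open>X\<close> is
  a probability measure on the path space of all sources \<open>{1..K}\<close>.
\<close>

definition source_space :: "(nat \<Rightarrow> nat \<Rightarrow> 'a measure) \<Rightarrow> nat \<Rightarrow> (nat \<Rightarrow> 'a) measure" where
  "source_space S k = (\<Pi>\<^sub>M n\<in>{1..}. S k n)"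

definition path_space ::
  "(nat \<Rightarrow> nat \<Rightarrow> 'a measure) \<Rightarrow> nat set \<Rightarrow> (nat \<Rightarrow> nat \<Rightarrow> 'a) measure" where
  "path_space S s = (\<Pi>\<^sub>M k\<in>s. source_space S k)"

text \<open>\<open>obs_sigma S s n\<close> is the sigma-algebra generated by the first \<open>n\<close> observations of the
  sources in \<open>s\<close>; only its space and measurable sets are relevant.\<close>

definition obs_sigma ::
  "(nat \<Rightarrow> nat \<Rightarrow> 'a measure) \<Rightarrow> nat set \<Rightarrow> nat \<Rightarrow> (nat \<Rightarrow> nat \<Rightarrow> 'a) measure" where
  "obs_sigma S s n =
     vimage_algebra (space (path_space S s))
       (\<lambda>x. \<lambda>k\<in>s. \<lambda>m\<in>{1..n}. x k m) (\<Pi>\<^sub>M k\<in>s. \<Pi>\<^sub>M m\<in>{1..n}. S k m)"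

definition sub_law ::
  "(nat \<Rightarrow> nat \<Rightarrow> 'a measure) \<Rightarrow> nat set \<Rightarrow> (nat \<Rightarrow> nat \<Rightarrow> 'a) measure
    \<Rightarrow> (nat \<Rightarrow> nat \<Rightarrow> 'a) measure" where
  "sub_law S s P = distr P (path_space S s) (\<lambda>x. restrict x s)"

text \<open>\<open>P\<^sup>k\<close> is \<open>sub_law S {k} P\<close>, a law of one-source families; for the product it is transported
  to the path space of source \<open>k\<close>.\<close>

definition independent_sources ::
  "nat \<Rightarrow> (nat \<Rightarrow> nat \<Rightarrow> 'a measure) \<Rightarrow> (nat \<Rightarrow> nat \<Rightarrow> 'a) measure \<Rightarrow> bool" where
  "independent_sources K S P \<longleftrightarrow>
     P = (\<Pi>\<^sub>M k\<in>{1..K}. distr (sub_law S {k} P) (source_space S k) (\<lambda>x. x k))"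


section \<open>Hypotheses\<close>

definition Psi_between :: "nat \<Rightarrow> nat \<Rightarrow> nat \<Rightarrow> nat set set" where
  "Psi_between K l u = {A. A \<subseteq> {1..K} \<and> l \<le> card A \<and> card A \<le> u}"

definition signals ::
  "nat \<Rightarrow> (nat \<Rightarrow> nat \<Rightarrow> 'a measure) \<Rightarrow> (nat \<Rightarrow> (nat \<Rightarrow> nat \<Rightarrow> 'a) measure set)
    \<Rightarrow> (nat \<Rightarrow> nat \<Rightarrow> 'a) measure \<Rightarrow> nat set" where
  "signals K S G P = {k\<in>{1..K}. sub_law S {k} P \<in> G k}"

definition P_Psi ::
  "nat \<Rightarrow> (nat \<Rightarrow> nat \<Rightarrow> 'a measure) \<Rightarrow> (nat \<Rightarrow> nat \<Rightarrow> 'a) measure set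
    \<Rightarrow> (nat \<Rightarrow> (nat \<Rightarrow> nat \<Rightarrow> 'a) measure set) \<Rightarrow> (nat \<Rightarrow> (nat \<Rightarrow> nat \<Rightarrow> 'a) measure set)
    \<Rightarrow> nat set set \<Rightarrow> (nat \<Rightarrow> nat \<Rightarrow> 'a) measure set" where
  "P_Psi K S \<P> H G \<Psi> =
     {P\<in>\<P>. (\<forall>k\<in>{1..K}. sub_law S {k} P \<in> H k \<union> G k) \<and> signals K S G P \<in> \<Psi>}"

definition H_null ::
  "nat \<Rightarrow> (nat \<Rightarrow> nat \<Rightarrow> 'a measure) \<Rightarrow> (nat \<Rightarrow> nat \<Rightarrow> 'a) measure set
    \<Rightarrow> (nat \<Rightarrow> (nat \<Rightarrow> nat \<Rightarrow> 'a) measure set) \<Rightarrow> (nat \<Rightarrow> nat \<Rightarrow> 'a) measure set" where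
  "H_null K S \<P> H = {P\<in>\<P>. \<forall>k\<in>{1..K}. sub_law S {k} P \<in> H k}"

definition H_Psi ::
  "nat \<Rightarrow> (nat \<Rightarrow> nat \<Rightarrow> 'a measure) \<Rightarrow> (nat \<Rightarrow> nat \<Rightarrow> 'a) measure set
    \<Rightarrow> (nat \<Rightarrow> (nat \<Rightarrow> nat \<Rightarrow> 'a) measure set) \<Rightarrow> (nat \<Rightarrow> (nat \<Rightarrow> nat \<Rightarrow> 'a) measure set)
    \<Rightarrow> nat set set \<Rightarrow> nat \<Rightarrow> (nat \<Rightarrow> nat \<Rightarrow> 'a) measure set" where
  "H_Psi K S \<P> H G \<Psi> k =
     {P \<in> P_Psi K S \<P> H G \<Psi> - H_null K S \<P> H. k \<notin> signals K S G P}"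

definition G_Psi ::
  "nat \<Rightarrow> (nat \<Rightarrow> nat \<Rightarrow> 'a measure) \<Rightarrow> (nat \<Rightarrow> nat \<Rightarrow> 'a) measure set
    \<Rightarrow> (nat \<Rightarrow> (nat \<Rightarrow> nat \<Rightarrow> 'a) measure set) \<Rightarrow> (nat \<Rightarrow> (nat \<Rightarrow> nat \<Rightarrow> 'a) measure set)
    \<Rightarrow> nat set set \<Rightarrow> nat \<Rightarrow> (nat \<Rightarrow> nat \<Rightarrow> 'a) measure set" where
  "G_Psi K S \<P> H G \<Psi> k = {P \<in> P_Psi K S \<P> H G \<Psi>. k \<in> signals K S G P}"

definition hypotheses_setup ::
  "nat \<Rightarrow> (nat \<Rightarrow> nat \<Rightarrow> 'a measure) \<Rightarrow> (nat \<Rightarrow> nat \<Rightarrow> 'a) measure set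
    \<Rightarrow> (nat \<Rightarrow> (nat \<Rightarrow> nat \<Rightarrow> 'a) measure set) \<Rightarrow> (nat \<Rightarrow> (nat \<Rightarrow> nat \<Rightarrow> 'a) measure set) \<Rightarrow> bool"
  where
  "hypotheses_setup K S \<P> H G \<longleftrightarrow>
     finite \<P> \<and>
     (\<forall>P\<in>\<P>. prob_space P \<and> sets P = sets (path_space S {1..K})) \<and>
     (\<forall>k\<in>{1..K}. H k \<subseteq> sub_law S {k} ` \<P> \<and> G k \<subseteq> sub_law S {k} ` \<P> \<and>
        H k \<noteq> {} \<and> G k \<noteq> {} \<and> H k \<inter> G k = {})"

text \<open>Every choice of local laws whose set of signals is admissible is realised by some law in
  the family. Since the laws in \<open>P_Psi\<close> are products, this says that \<open>P_Psi\<close> consists of all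
  the admissible products. Without it the isolation statistics, which range over \<open>P_Psi\<close>, are not
  functions of the local statistics, which range over all of \<open>H k\<close> and \<open>G k\<close>.\<close>

definition all_local_combinations ::
  "nat \<Rightarrow> (nat \<Rightarrow> nat \<Rightarrow> 'a measure) \<Rightarrow> (nat \<Rightarrow> nat \<Rightarrow> 'a) measure set
    \<Rightarrow> (nat \<Rightarrow> (nat \<Rightarrow> nat \<Rightarrow> 'a) measure set) \<Rightarrow> (nat \<Rightarrow> (nat \<Rightarrow> nat \<Rightarrow> 'a) measure set)
    \<Rightarrow> nat set set \<Rightarrow> bool" where
  "all_local_combinations K S \<P> H G \<Psi> \<longleftrightarrow>
     (\<forall>q. (\<forall>k\<in>{1..K}. q k \<in> H k \<union> G k) \<and> {k\<in>{1..K}. q k \<in> G k} \<in> \<Psi> \<longrightarrow>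
        (\<exists>P\<in>\<P>. \<forall>k\<in>{1..K}. sub_law S {k} P = q k))"


section \<open>Likelihood ratios and standing assumptions\<close>

text \<open>In this section \<open>P\<close> and \<open>Q\<close> are laws on \<open>path_space S s\<close>.\<close>

definition law_on ::
  "(nat \<Rightarrow> nat \<Rightarrow> 'a measure) \<Rightarrow> nat set \<Rightarrow> nat \<Rightarrow> (nat \<Rightarrow> nat \<Rightarrow> 'a) measure
    \<Rightarrow> (nat \<Rightarrow> nat \<Rightarrow> 'a) measure" where
  "law_on S s n P = restr_to_subalg P (obs_sigma S s n)"

definition mutually_ac ::
  "(nat \<Rightarrow> nat \<Rightarrow> 'a measure) \<Rightarrow> nat set \<Rightarrow> nat \<Rightarrow> (nat \<Rightarrow> nat \<Rightarrow> 'a) measure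
    \<Rightarrow> (nat \<Rightarrow> nat \<Rightarrow> 'a) measure \<Rightarrow> bool" where
  "mutually_ac S s n P Q \<longleftrightarrow>
     absolutely_continuous (law_on S s n Q) (law_on S s n P) \<and>
     absolutely_continuous (law_on S s n P) (law_on S s n Q)"

text \<open>\<open>RN_deriv M N\<close> is \<open>dN/dM\<close>, in an unspecified version; under mutual absolute continuity it is
  almost surely positive and finite.\<close>

definition lik_ratio ::
  "(nat \<Rightarrow> nat \<Rightarrow> 'a measure) \<Rightarrow> nat set \<Rightarrow> nat \<Rightarrow> (nat \<Rightarrow> nat \<Rightarrow> 'a) measure
    \<Rightarrow> (nat \<Rightarrow> nat \<Rightarrow> 'a) measure \<Rightarrow> (nat \<Rightarrow> nat \<Rightarrow> 'a) \<Rightarrow> real" where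
  "lik_ratio S s n P Q x = enn2real (RN_deriv (law_on S s n Q) (law_on S s n P) x)"

definition log_lik_ratio ::
  "(nat \<Rightarrow> nat \<Rightarrow> 'a measure) \<Rightarrow> nat set \<Rightarrow> nat \<Rightarrow> (nat \<Rightarrow> nat \<Rightarrow> 'a) measure
    \<Rightarrow> (nat \<Rightarrow> nat \<Rightarrow> 'a) measure \<Rightarrow> (nat \<Rightarrow> nat \<Rightarrow> 'a) \<Rightarrow> real" where
  "log_lik_ratio S s n P Q x = ln (lik_ratio S s n P Q x)"

definition has_information ::
  "(nat \<Rightarrow> nat \<Rightarrow> 'a measure) \<Rightarrow> nat set \<Rightarrow> (nat \<Rightarrow> nat \<Rightarrow> 'a) measure
    \<Rightarrow> (nat \<Rightarrow> nat \<Rightarrow> 'a) measure \<Rightarrow> real \<Rightarrow> bool" where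
  "has_information S s P Q I \<longleftrightarrow>
     (\<forall>\<rho>>I. (\<lambda>n. measure P {x \<in> space P.
          Max ((\<lambda>m. log_lik_ratio S s m P Q x) ` {1..n}) \<ge> real n * \<rho>}) \<longlonglongrightarrow> 0) \<and>
     (\<forall>\<rho><I. summable (\<lambda>n. measure P {x \<in> space P. log_lik_ratio S s n P Q x < real n * \<rho>}))"

definition standing_assumptions ::
  "nat \<Rightarrow> (nat \<Rightarrow> nat \<Rightarrow> 'a measure) \<Rightarrow> (nat \<Rightarrow> nat \<Rightarrow> 'a) measure set
    \<Rightarrow> (nat \<Rightarrow> (nat \<Rightarrow> nat \<Rightarrow> 'a) measure set) \<Rightarrow> (nat \<Rightarrow> (nat \<Rightarrow> nat \<Rightarrow> 'a) measure set)
    \<Rightarrow> nat set set \<Rightarrow> bool" where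
  "standing_assumptions K S \<P> H G \<Psi> \<longleftrightarrow>
     (\<forall>k\<in>{1..K}. \<forall>P \<in> G_Psi K S \<P> H G \<Psi> k \<union> H_null K S \<P> H.
        \<forall>Q \<in> H_Psi K S \<P> H G \<Psi> k \<union> H_null K S \<P> H.
        \<forall>s. k \<in> s \<and> s \<subseteq> {1..K} \<longrightarrow>
          (\<forall>n\<ge>1. mutually_ac S s n (sub_law S s P) (sub_law S s Q))) \<and>
     (\<forall>k\<in>{1..K}. \<forall>P \<in> G_Psi K S \<P> H G \<Psi> k.
        \<forall>Q \<in> H_Psi K S \<P> H G \<Psi> k \<union> H_null K S \<P> H.
        \<forall>s. k \<in> s \<and> s \<subseteq> {1..K} \<longrightarrow>
          (\<exists>I>0. has_information S s (sub_law S s P) (sub_law S s Q) I) \<and>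
          (\<exists>J>0. has_information S s (sub_law S s Q) (sub_law S s P) J))"


section \<open>Test statistics\<close>

definition iso_stat ::
  "nat \<Rightarrow> (nat \<Rightarrow> nat \<Rightarrow> 'a measure) \<Rightarrow> (nat \<Rightarrow> nat \<Rightarrow> 'a) measure set
    \<Rightarrow> (nat \<Rightarrow> (nat \<Rightarrow> nat \<Rightarrow> 'a) measure set) \<Rightarrow> (nat \<Rightarrow> (nat \<Rightarrow> nat \<Rightarrow> 'a) measure set)
    \<Rightarrow> nat set set \<Rightarrow> (nat \<Rightarrow> nat \<Rightarrow> 'a) measure \<Rightarrow> (nat \<Rightarrow> nat \<Rightarrow> 'a) \<Rightarrow> nat \<Rightarrow> nat \<Rightarrow> real" where
  "iso_stat K S \<P> H G \<Psi> P0' x n k =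
     Max ((\<lambda>P. lik_ratio S {1..K} n P P0' x) ` G_Psi K S \<P> H G \<Psi> k) /
     Max ((\<lambda>P. lik_ratio S {1..K} n P P0' x) ` H_Psi K S \<P> H G \<Psi> k)"

definition local_stat ::
  "(nat \<Rightarrow> nat \<Rightarrow> 'a measure)
    \<Rightarrow> (nat \<Rightarrow> (nat \<Rightarrow> nat \<Rightarrow> 'a) measure set) \<Rightarrow> (nat \<Rightarrow> (nat \<Rightarrow> nat \<Rightarrow> 'a) measure set)
    \<Rightarrow> (nat \<Rightarrow> (nat \<Rightarrow> nat \<Rightarrow> 'a) measure) \<Rightarrow> (nat \<Rightarrow> nat \<Rightarrow> 'a) \<Rightarrow> nat \<Rightarrow> nat \<Rightarrow> real" where
  "local_stat S H G P0 x n k =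
     Max ((\<lambda>P. lik_ratio S {k} n P (P0 k) (restrict x {k})) ` G k) /
     Max ((\<lambda>P. lik_ratio S {k} n P (P0 k) (restrict x {k})) ` H k)"

definition ordered :: "nat \<Rightarrow> (nat \<Rightarrow> real) \<Rightarrow> nat \<Rightarrow> real" where
  "ordered K L i = rev (sort (map L [1..<Suc K])) ! (i - 1)"

definition num_above :: "nat \<Rightarrow> (nat \<Rightarrow> real) \<Rightarrow> nat" where
  "num_above K L = card {k\<in>{1..K}. L k > 1}"


section \<open>Stopping times\<close>

text \<open>Times start at 1, and the infimum over no time is \<open>\<infinity>\<close>. In the definitions below \<open>L n k\<close>
  is the value of the statistic of unit \<open>k\<close> at time \<open>n\<close>.\<close>

definition first_time :: "(nat \<Rightarrow> bool) \<Rightarrow> enat" where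
  "first_time E = Inf (enat ` {n. n \<ge> 1 \<and> E n})"

definition T_star ::
  "nat \<Rightarrow> nat set set \<Rightarrow> real \<Rightarrow> real \<Rightarrow> (nat \<Rightarrow> nat \<Rightarrow> real) \<Rightarrow> enat" where
  "T_star K \<Psi> A B L = first_time (\<lambda>n. {k\<in>{1..K}. L n k > 1} \<in> \<Psi> \<and>
     (\<forall>k\<in>{1..K}. L n k \<notin> {1/A<..<B}))"

definition T1 :: "nat \<Rightarrow> nat \<Rightarrow> real \<Rightarrow> real \<Rightarrow> (nat \<Rightarrow> nat \<Rightarrow> real) \<Rightarrow> enat" where
  "T1 K l A B L = first_time (\<lambda>n. num_above K (L n) < l \<and>
     ordered K (L n) l \<ge> ordered K (L n) (l + 1) * max A B)"

definition T2 :: "nat \<Rightarrow> nat \<Rightarrow> real \<Rightarrow> real \<Rightarrow> (nat \<Rightarrow> nat \<Rightarrow> real) \<Rightarrow> enat" where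
  "T2 K l A B L = first_time (\<lambda>n. num_above K (L n) = l \<and>
     ordered K (L n) (l + 1) \<le> min (1/A) (ordered K (L n) l / B))"

definition T3 :: "nat \<Rightarrow> nat \<Rightarrow> real \<Rightarrow> real \<Rightarrow> (nat \<Rightarrow> nat \<Rightarrow> real) \<Rightarrow> enat" where
  "T3 K l A B L = first_time (\<lambda>n. num_above K (L n) > l \<and>
     (\<forall>k\<in>{1..K}. L n k \<notin> {1/A<..<B}))"

definition T4 :: "nat \<Rightarrow> nat \<Rightarrow> nat \<Rightarrow> real \<Rightarrow> real \<Rightarrow> (nat \<Rightarrow> nat \<Rightarrow> real) \<Rightarrow> enat" where
  "T4 K l u A B L = first_time (\<lambda>n. l < num_above K (L n) \<and> num_above K (L n) < u \<and>
     (\<forall>k\<in>{1..K}. L n k \<notin> {1/A<..<B}))"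

definition T5 :: "nat \<Rightarrow> nat \<Rightarrow> real \<Rightarrow> real \<Rightarrow> (nat \<Rightarrow> nat \<Rightarrow> real) \<Rightarrow> enat" where
  "T5 K u A B L = first_time (\<lambda>n. num_above K (L n) = u \<and>
     ordered K (L n) u \<ge> max B (A * ordered K (L n) (u + 1)))"

definition T6 :: "nat \<Rightarrow> nat \<Rightarrow> real \<Rightarrow> real \<Rightarrow> (nat \<Rightarrow> nat \<Rightarrow> real) \<Rightarrow> enat" where
  "T6 K u A B L = first_time (\<lambda>n. num_above K (L n) > u \<and>
     ordered K (L n) u \<ge> ordered K (L n) (u + 1) * max A B)"

end

theory Submission
  imports Defs
begin

text \<open>
  Write \<open>\<Lambda>\<^sub>k\<close> for the local statistic of source \<open>k\<close>. Under independence the likelihood of an admissible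
  law is, up to a factor common to all laws, the product over the sources of the likelihoods of its
  marginals. The factor is the likelihood ratio of the product of the reference marginals against
  \<open>P0'\<close>: this product law mediates between the admissible product laws and the arbitrary law \<open>P0'\<close>
  (\<open>AE_global_lik_ratio\<close>). Every choice of marginals with an admissible set of signals occurs, so
  the maximum over laws can be taken one source at a time: with \<open>A\<close> the set of signals, the largest
  likelihood is a constant times the product of \<open>\<Lambda>\<^sub>j\<close> over \<open>j \<in> A\<close> (\<open>Max_prod_choice\<close>). Hence almost
  surely, at all times, the isolation statistic of \<open>k\<close> is the ratio of the maxima of
  \<open>\<Prod>j\<in>A. \<Lambda>\<^sub>j\<close> over the admissible sets containing \<open>k\<close> and over those omitting \<open>k\<close>.
  From here on everything is a statement about finitely many positive numbers.

  Both maxima are found greedily: take the largest values, as many as exceed 1, but at least \<open>l\<close>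
  and at most \<open>u\<close> (both lowered by one when choosing the companions of \<open>k\<close>). A threshold
  separating the chosen values from the others certifies optimality
  (\<open>prod_le_prod_by_threshold\<close>). If the values above 1, without that of \<open>k\<close>, form an
  admissible set with room for \<open>k\<close>, the ratio is \<open>\<Lambda>\<^sub>k\<close> itself (\<open>iso_ratio_local\<close>). If a bound is
  active, \<open>k\<close> has to be exchanged for a marginal element \<open>e\<close>, and the ratio is \<open>\<Lambda>\<^sub>k / \<Lambda>\<^sub>e\<close>
  (\<open>iso_ratio_swap\<close>); here \<open>e\<close> is one of the two ranks next to the active bound. Which case applies
  depends only on the number \<open>p\<close> of values above 1, and this produces the events that
  define \<open>T1\<close> to \<open>T6\<close>.

  When every unit is compared with the value across a cut after rank \<open>t\<close>, the units of rank at most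
  \<open>t\<close> have statistics at least 1 and the others at most 1. A statistic equal to 1
  lies in the forbidden interval \<open>(1/A, B)\<close>, so ties at the cut never stop the test, and leaving the
  interval already makes the selected set equal to the \<open>t\<close> top-ranked units.
\<close>

section \<open>First times\<close>

lemma first_time_cong:
  assumes "\<And>n. n \<ge> 1 \<Longrightarrow> E n \<longleftrightarrow> F n"
  shows "first_time E = first_time F"
proof -
  have "{n. n \<ge> 1 \<and> E n} = {n. n \<ge> 1 \<and> F n}" using assms by auto
  then show ?thesis by (simp add: first_time_def)
qed

lemma first_time_disj:
  "first_time (\<lambda>n. E n \<or> F n) = min (first_time E) (first_time F)"
proof -
  have "{n. n \<ge> 1 \<and> (E n \<or> F n)} = {n. n \<ge> 1 \<and> E n} \<union> {n. n \<ge> 1 \<and> F n}" by auto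
  then show ?thesis
    by (simp add: first_time_def image_Un Inf_union_distrib inf_min)
qed

section \<open>Greedy maximisation of products over sets of bounded size\<close>

text \<open>
  The isolation statistic as a function of the local statistics \<open>L\<close> alone; the theorem reduces to
  it almost surely.
\<close>

definition iso_ratio :: "nat set set \<Rightarrow> (nat \<Rightarrow> real) \<Rightarrow> nat \<Rightarrow> real" where
  "iso_ratio \<Psi> L k = Max (prod L ` {A\<in>\<Psi>. k \<in> A}) / Max (prod L ` {A\<in>\<Psi>. k \<notin> A})"

lemma finite_Psi_between: "finite (Psi_between K l u)"
  unfolding Psi_between_def by (rule finite_subset[of _ "Pow {1..K}"]) auto

text \<open>
  Weak duality. Dividing all values by \<open>t\<close> turns the members of \<open>T\<close> into factors at least 1 and
  everything outside into factors at most 1, so \<open>T\<close> maximises the rescaled product. Undoing the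
  rescaling costs a power of \<open>t\<close>, and the cardinality conditions give it the right direction.
\<close>

lemma prod_le_prod_by_threshold:
  fixes L :: "nat \<Rightarrow> real"
  assumes fin: "finite A" "finite T" and t: "t > 0"
    and T: "\<And>j. j \<in> T \<Longrightarrow> t \<le> L j"
    and A: "\<And>j. j \<in> A - T \<Longrightarrow> 0 < L j \<and> L j \<le> t"
    and card: "t < 1 \<Longrightarrow> card T \<le> card A" "t > 1 \<Longrightarrow> card A \<le> card T"
  shows "prod L A \<le> prod L T"
proof -
  have cA: "card A = card (A \<inter> T) + card (A - T)"
    and cT: "card T = card (A \<inter> T) + card (T - A)"
    using fin by (metis card_Int_Diff, metis card_Int_Diff Int_commute)
  have pow: "t ^ card (A - T) \<le> t ^ card (T - A)"
  proof (cases t "1::real" rule: linorder_cases)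
    case less
    then show ?thesis using card(1) t cA cT by (intro power_decreasing) auto
  next
    case greater
    then show ?thesis using card(2) t cA cT by (intro power_increasing) auto
  qed auto
  have "prod L (A - T) \<le> (\<Prod>j\<in>A - T. t)"
    using A by (intro prod_mono) (auto intro: less_imp_le)
  also have "\<dots> \<le> (\<Prod>j\<in>T - A. t)" using pow by simp
  also have "\<dots> \<le> prod L (T - A)" using T t by (intro prod_mono) auto
  finally have le: "prod L (A - T) \<le> prod L (T - A)" .
  have "0 \<le> prod L (A \<inter> T)" using T t by (intro prod_nonneg) force
  then have "prod L (A \<inter> T) * prod L (A - T) \<le> prod L (A \<inter> T) * prod L (T - A)"
    using le by (rule mult_left_mono[rotated])
  moreover have "prod L A = prod L (A \<inter> T) * prod L (A - T)"
    using fin by (metis prod.Int_Diff)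
  moreover have "prod L T = prod L (A \<inter> T) * prod L (T - A)"
    using fin by (metis prod.Int_Diff Int_commute)
  ultimately show ?thesis by simp
qed

text \<open>
  Greedy optimality for the two maxima in \<open>iso_ratio\<close>. The conditions on \<open>t\<close> are complementary
  slackness: a threshold below 1 means that the set is padded up to its minimal size \<open>l\<close>, and one above 1
  that it is truncated at its maximal size \<open>u\<close>.
\<close>

lemma Max_prod_Psi_between:
  fixes L :: "nat \<Rightarrow> real"
  assumes pos: "\<And>j. j \<in> {1..K} \<Longrightarrow> L j > 0"
    and k: "k \<in> {1..K}"
    and T: "T \<subseteq> {1..K} - {k}" "t > 0"
    and sep: "\<And>j. j \<in> T \<Longrightarrow> t \<le> L j" "\<And>j. j \<in> {1..K} - {k} - T \<Longrightarrow> L j \<le> t"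
  shows Max_prod_without:
      "\<lbrakk>l \<le> card T; card T \<le> u; t < 1 \<Longrightarrow> card T = l; t > 1 \<Longrightarrow> card T = u\<rbrakk> \<Longrightarrow>
        Max (prod L ` {A\<in>Psi_between K l u. k \<notin> A}) = prod L T"
    and Max_prod_with:
      "\<lbrakk>l \<le> Suc (card T); Suc (card T) \<le> u; t < 1 \<Longrightarrow> Suc (card T) = l;
        t > 1 \<Longrightarrow> Suc (card T) = u\<rbrakk> \<Longrightarrow>
        Max (prod L ` {A\<in>Psi_between K l u. k \<in> A}) = L k * prod L T"
proof -
  have finT: "finite T" using T(1) finite_subset by auto
  show "Max (prod L ` {A\<in>Psi_between K l u. k \<notin> A}) = prod L T"
    if c: "l \<le> card T" "card T \<le> u" "t < 1 \<Longrightarrow> card T = l" "t > 1 \<Longrightarrow> card T = u"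
  proof (rule Max_eqI)
    show "finite (prod L ` {A\<in>Psi_between K l u. k \<notin> A})" using finite_Psi_between by simp
    show "prod L T \<in> prod L ` {A\<in>Psi_between K l u. k \<notin> A}"
      using T(1) c(1,2) by (intro imageI) (auto simp: Psi_between_def)
    fix y assume "y \<in> prod L ` {A\<in>Psi_between K l u. k \<notin> A}"
    then obtain A where A: "y = prod L A" "A \<subseteq> {1..K}" "l \<le> card A" "card A \<le> u" "k \<notin> A"
      by (auto simp: Psi_between_def)
    show "y \<le> prod L T" unfolding A(1)
    proof (rule prod_le_prod_by_threshold[where t = t])
      show "finite A" using A(2) finite_subset by auto
      show "0 < L j \<and> L j \<le> t" if "j \<in> A - T" for j
        using that A pos[of j] sep(2)[of j] by blast
    qed (use finT T sep(1) A c in auto)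
  qed
  show "Max (prod L ` {A\<in>Psi_between K l u. k \<in> A}) = L k * prod L T"
    if c: "l \<le> Suc (card T)" "Suc (card T) \<le> u" "t < 1 \<Longrightarrow> Suc (card T) = l"
      "t > 1 \<Longrightarrow> Suc (card T) = u"
  proof (rule Max_eqI)
    have kT: "k \<notin> T" using T(1) by auto
    have ins: "prod L (insert k T) = L k * prod L T" using kT finT by simp
    show "finite (prod L ` {A\<in>Psi_between K l u. k \<in> A})" using finite_Psi_between by simp
    show "L k * prod L T \<in> prod L ` {A\<in>Psi_between K l u. k \<in> A}"
      unfolding ins[symmetric] using T(1) k kT finT c(1,2)
      by (intro imageI) (auto simp: Psi_between_def)
    fix y assume "y \<in> prod L ` {A\<in>Psi_between K l u. k \<in> A}"
    then obtain A where A: "y = prod L A" "A \<subseteq> {1..K}" "l \<le> card A" "card A \<le> u" "k \<in> A"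
      by (auto simp: Psi_between_def)
    have finA: "finite A" using A(2) finite_subset by auto
    have cA: "card A = Suc (card (A - {k}))" using finA A(5) by (rule card.remove)
    have "prod L (A - {k}) \<le> prod L T"
    proof (rule prod_le_prod_by_threshold[where t = t])
      show "0 < L j \<and> L j \<le> t" if "j \<in> A - {k} - T" for j
        using that A pos[of j] sep(2)[of j] by blast
      show "t < 1 \<Longrightarrow> card T \<le> card (A - {k})" using c(3) cA A(3) by linarith
      show "t > 1 \<Longrightarrow> card (A - {k}) \<le> card T" using c(4) cA A(4) by linarith
    qed (use finT finA T(2) sep(1) in auto)
    then show "y \<le> L k * prod L T"
      using pos[OF k] prod.remove[OF finA A(5), of L] by (simp add: A(1))
  qed
qed

text \<open>
  Admitting \<open>k\<close> into an optimal set \<open>T\<close> forces out its marginal element \<open>e\<close>. The same threshold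
  \<open>L e\<close> certifies both \<open>T\<close> among the sets omitting \<open>k\<close> and \<open>T - {e}\<close> as the companion of \<open>k\<close>, whose
  size bounds are lower by one.
\<close>

lemma iso_ratio_swap:
  fixes L :: "nat \<Rightarrow> real"
  assumes pos: "\<And>j. j \<in> {1..K} \<Longrightarrow> L j > 0"
    and k: "k \<in> {1..K}"
    and T: "T \<subseteq> {1..K} - {k}" "e \<in> T"
    and sep: "\<And>j. j \<in> T \<Longrightarrow> L e \<le> L j" "\<And>j. j \<in> {1..K} - {k} - T \<Longrightarrow> L j \<le> L e"
    and card: "l \<le> card T" "card T \<le> u" "L e < 1 \<Longrightarrow> card T = l" "L e > 1 \<Longrightarrow> card T = u"
  shows "iso_ratio (Psi_between K l u) L k = L k / L e"
proof -
  have finT: "finite T" using T(1) finite_subset by auto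
  have e: "L e > 0" using T pos by auto
  have cT: "card T = Suc (card (T - {e}))" using finT T(2) by (rule card.remove)
  have "Max (prod L ` {A\<in>Psi_between K l u. k \<notin> A}) = prod L T"
    using pos k T(1) e sep card by (rule Max_prod_without)
  moreover have "Max (prod L ` {A\<in>Psi_between K l u. k \<in> A}) = L k * prod L (T - {e})"
  proof (rule Max_prod_with[where t = "L e"])
    show "L j \<le> L e" if "j \<in> {1..K} - {k} - (T - {e})" for j
      using that sep(2)[of j] by (cases "j = e") auto
    show "l \<le> Suc (card (T - {e}))" "Suc (card (T - {e})) \<le> u"
      "L e < 1 \<Longrightarrow> Suc (card (T - {e})) = l" "L e > 1 \<Longrightarrow> Suc (card (T - {e})) = u"
      unfolding cT[symmetric] by (fact card)+
  qed (use pos k T e sep in auto)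
  moreover have "prod L T = L e * prod L (T - {e})"
    using prod.remove[OF finT T(2)] .
  moreover have "prod L (T - {e}) > 0" using T pos by (intro prod_pos) auto
  ultimately show ?thesis using e by (simp add: iso_ratio_def)
qed

text \<open>
  If \<open>T\<close> consists of the other values above 1, and both \<open>T\<close> and \<open>insert k T\<close> have admissible
  size, the threshold 1 certifies both, so \<open>k\<close> joins without displacing anything.
\<close>

lemma iso_ratio_local:
  fixes L :: "nat \<Rightarrow> real"
  assumes pos: "\<And>j. j \<in> {1..K} \<Longrightarrow> L j > 0"
    and k: "k \<in> {1..K}"
    and T: "T \<subseteq> {1..K} - {k}"
    and sep: "\<And>j. j \<in> T \<Longrightarrow> 1 \<le> L j" "\<And>j. j \<in> {1..K} - {k} - T \<Longrightarrow> L j \<le> 1"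
    and card: "l \<le> card T" "card T < u"
  shows "iso_ratio (Psi_between K l u) L k = L k"
proof -
  have "Max (prod L ` {A\<in>Psi_between K l u. k \<notin> A}) = prod L T"
    by (rule Max_prod_without[where t = 1]) (use assms in auto)
  moreover have "Max (prod L ` {A\<in>Psi_between K l u. k \<in> A}) = L k * prod L T"
    by (rule Max_prod_with[where t = 1]) (use assms in auto)
  moreover have "prod L T > 0" using T pos by (intro prod_pos) auto
  ultimately show ?thesis by (simp add: iso_ratio_def)
qed

section \<open>The stopping rule for ranked statistics\<close>

text \<open>
  The stopping rule of \<open>T_star\<close> at a single time, for the values \<open>I\<close> of the isolation statistics.
\<close>

definition stops :: "nat \<Rightarrow> nat set set \<Rightarrow> real \<Rightarrow> real \<Rightarrow> (nat \<Rightarrow> real) \<Rightarrow> bool" where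
  "stops K \<Psi> A B I \<longleftrightarrow>
     {k\<in>{1..K}. I k > 1} \<in> \<Psi> \<and> (\<forall>k\<in>{1..K}. I k \<notin> {1/A<..<B})"

context
  fixes K l u :: nat and A B :: real and a :: "nat \<Rightarrow> real"
  assumes AB: "A > 1" "B > 1"
    and pos: "\<And>i. i \<in> {1..K} \<Longrightarrow> a i > 0"
    and anti: "\<And>i j. 1 \<le> i \<Longrightarrow> i \<le> j \<Longrightarrow> j \<le> K \<Longrightarrow> a j \<le> a i"
begin

lemma above_threshold:
  assumes "y \<ge> 1" shows "y \<notin> {1/A<..<B} \<longleftrightarrow> y \<ge> B"
proof -
  have "1/A < 1" using AB by simp
  then have "1/A < y" using assms by linarith
  then show ?thesis by auto
qed

lemma below_threshold:
  assumes "y \<le> 1" shows "y \<notin> {1/A<..<B} \<longleftrightarrow> y \<le> 1/A"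
  using assms AB by auto

text \<open>
  With \<open>t\<close> the size of the optimal sets, removing a top-ranked unit \<open>r\<close> makes rank \<open>t + 1\<close> the marginal
  one. Here and below, \<open>a\<close> lists the local statistics in decreasing order.
\<close>

lemma sorted_above_cut:
  assumes t: "l \<le> t" "t \<le> u" "1 \<le> t" "t < K" and r: "1 \<le> r" "r \<le> t"
    and c: "t = l \<or> a (Suc t) \<ge> 1" "t = u \<or> a (Suc t) \<le> 1"
  shows "iso_ratio (Psi_between K l u) a r = a r / a (Suc t)"
proof (rule iso_ratio_swap[where T = "{1..Suc t} - {r}"])
  have "card ({1..Suc t} - {r}) = t" using r by (subst card_Diff_singleton) auto
  then show "l \<le> card ({1..Suc t} - {r})" "card ({1..Suc t} - {r}) \<le> u"
    "a (Suc t) < 1 \<Longrightarrow> card ({1..Suc t} - {r}) = l"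
    "a (Suc t) > 1 \<Longrightarrow> card ({1..Suc t} - {r}) = u" using t c by auto
  show "a (Suc t) \<le> a j" if "j \<in> {1..Suc t} - {r}" for j using that t by (intro anti) auto
  show "a j \<le> a (Suc t)" if "j \<in> {1..K} - {r} - ({1..Suc t} - {r})" for j
    using that by (intro anti) auto
qed (use t r pos in auto)

lemma sorted_below_cut:
  assumes t: "l \<le> t" "t \<le> u" "1 \<le> t" and r: "t < r" "r \<le> K"
    and c: "t = l \<or> a t \<ge> 1" "t = u \<or> a t \<le> 1"
  shows "iso_ratio (Psi_between K l u) a r = a r / a t"
proof (rule iso_ratio_swap[where T = "{1..t}"])
  show "l \<le> card {1..t}" "card {1..t} \<le> u"
    "a t < 1 \<Longrightarrow> card {1..t} = l" "a t > 1 \<Longrightarrow> card {1..t} = u" using t c by auto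
  show "a t \<le> a j" if "j \<in> {1..t}" for j using that t r by (intro anti) auto
  show "a j \<le> a t" if "j \<in> {1..K} - {r} - {1..t}" for j using that t by (intro anti) auto
qed (use t r pos in auto)

lemma sorted_local:
  assumes r: "r \<in> {1..K}" and q: "q \<le> K"
    and sep: "\<And>i. i \<in> {1..q} \<Longrightarrow> a i \<ge> 1" "\<And>i. i \<in> {Suc q..K} \<Longrightarrow> a i \<le> 1"
    and c: "if r \<le> q then l < q \<and> q \<le> u else l \<le> q \<and> q < u"
  shows "iso_ratio (Psi_between K l u) a r = a r"
proof (rule iso_ratio_local[where T = "{1..q} - {r}"])
  have "card ({1..q} - {r}) = (if r \<le> q then q - 1 else q)"
    using r by (subst card_Diff_singleton_if) auto
  then show "l \<le> card ({1..q} - {r})" "card ({1..q} - {r}) < u"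
    using c by (auto split: if_splits)
  show "a j \<le> 1" if "j \<in> {1..K} - {r} - ({1..q} - {r})" for j using that by (intro sep(2)) auto
qed (use r q sep(1) pos in auto)

lemma segment_in_Psi:
  assumes "l \<le> t" "t \<le> u" "t \<le> K" "\<And>r. r \<in> {1..K} \<Longrightarrow> I r > 1 \<longleftrightarrow> r \<le> t"
  shows "{r\<in>{1..K}. I r > (1::real)} \<in> Psi_between K l u"
proof -
  have "{r\<in>{1..K}. I r > 1} = {1..t}" using assms by fastforce
  then show ?thesis using assms by (auto simp: Psi_between_def)
qed

text \<open>
  The threshold conditions at the ranks \<open>t\<close> and \<open>t + 1\<close> next to the cut imply those at all
  other ranks. The statistic at rank \<open>t\<close> is at least 1 and that at rank \<open>t + 1\<close> at most 1, both being one
  in case of a tie; as 1 lies in \<open>(1/A, B)\<close>, they can leave it only upwards and downwards,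
  respectively.
\<close>

lemma stops_at_cut:
  assumes t: "l \<le> t" "t \<le> u" "1 \<le> t" "t < K"
    and high: "\<And>r. 1 \<le> r \<Longrightarrow> r \<le> t \<Longrightarrow> I r = a r / a (Suc t)"
    and low: "\<And>r. t < r \<Longrightarrow> r \<le> K \<Longrightarrow> I r = a r / a t"
  shows "stops K (Psi_between K l u) A B I \<longleftrightarrow> a t \<ge> a (Suc t) * max A B"
proof
  have p: "a t > 0" "a (Suc t) > 0" "a (Suc t) \<le> a t" using t pos anti by auto
  { assume "stops K (Psi_between K l u) A B I"
    then have "I t \<notin> {1/A<..<B}" "I (Suc t) \<notin> {1/A<..<B}" using t by (auto simp: stops_def)
    moreover have "I t \<ge> 1" "I (Suc t) \<le> 1" using high[of t] low[of "Suc t"] t p by auto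
    ultimately have "I t \<ge> B" "I (Suc t) \<le> 1/A"
      using above_threshold below_threshold by blast+
    then show "a t \<ge> a (Suc t) * max A B"
      using high[of t] low[of "Suc t"] t p AB by (auto simp: field_simps max_def)
  }
  assume "a t \<ge> a (Suc t) * max A B"
  moreover have "a (Suc t) * A \<le> a (Suc t) * max A B" "a (Suc t) * B \<le> a (Suc t) * max A B"
    using p by auto
  ultimately have e: "a t \<ge> a (Suc t) * A" "a t \<ge> a (Suc t) * B" by linarith+
  have hi: "I r \<ge> B" if "1 \<le> r" "r \<le> t" for r
  proof -
    have "B * a (Suc t) \<le> a r" using e(2) anti[of r t] that t by (simp add: mult.commute)
    then show ?thesis using high[OF that] p by (simp add: le_divide_eq)
  qed
  have lo: "I r \<le> 1/A" if "t < r" "r \<le> K" for r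
  proof -
    have "a r * A \<le> a (Suc t) * A" using that AB anti[of "Suc t" r] by auto
    then have "a r * A \<le> a t" using e(1) by linarith
    then have "I r * A \<le> 1" using low[OF that] p by simp
    then show ?thesis using AB by (simp add: le_divide_eq)
  qed
  have A1: "1/A < 1" using AB by simp
  have "I r > 1 \<longleftrightarrow> r \<le> t" if "r \<in> {1..K}" for r
    using hi[of r] lo[of r] that AB A1 by fastforce
  then have "{r\<in>{1..K}. I r > 1} \<in> Psi_between K l u" using t by (intro segment_in_Psi) auto
  moreover have "I r \<notin> {1/A<..<B}" if "r \<in> {1..K}" for r
    using hi[of r] lo[of r] that by (cases "r \<le> t") auto
  ultimately show "stops K (Psi_between K l u) A B I" by (simp add: stops_def)
qed

lemma stops_at_active_cut:
  assumes t: "l \<le> t" "t \<le> u" "1 \<le> t" "t < K"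
    and "t = l \<or> a (Suc t) \<ge> 1" "t = u \<or> a t \<le> 1"
  shows "stops K (Psi_between K l u) A B (iso_ratio (Psi_between K l u) a) \<longleftrightarrow>
    a t \<ge> a (Suc t) * max A B"
proof (rule stops_at_cut[OF t])
  have "a (Suc t) \<le> a t" using t anti by auto
  then have c: "t = l \<or> a t \<ge> 1" "t = u \<or> a (Suc t) \<le> 1" using assms by auto
  show "iso_ratio (Psi_between K l u) a r = a r / a (Suc t)" if "1 \<le> r" "r \<le> t" for r
    using sorted_above_cut assms c that by blast
  show "iso_ratio (Psi_between K l u) a r = a r / a t" if "t < r" "r \<le> K" for r
    using sorted_below_cut assms c that by blast
qed

context
  fixes p :: nat
  assumes p: "p \<le> K" "\<And>i. i \<in> {1..K} \<Longrightarrow> a i > 1 \<longleftrightarrow> i \<le> p"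
begin

text \<open>
  Exactly \<open>l\<close> values exceed 1: removing one of them forces rank \<open>l + 1\<close> in, whereas adding a
  further unit is free because \<open>l < u\<close>. The selected set is always the top \<open>l\<close>.
\<close>

lemma stops_at_lower:
  assumes "1 \<le> l" "l < u" "u \<le> K" "p = l"
  shows "stops K (Psi_between K l u) A B (iso_ratio (Psi_between K l u) a) \<longleftrightarrow>
    a (Suc l) \<le> min (1/A) (a l / B)" (is "stops _ _ _ _ ?I \<longleftrightarrow> _")
proof -
  have al: "a l > 1" "a (Suc l) \<le> 1" using p(2)[of l] p(2)[of "Suc l"] assms by auto
  have p0: "a (Suc l) > 0" using pos assms by auto
  have high: "?I r = a r / a (Suc l)" if "1 \<le> r" "r \<le> l" for r
    using sorted_above_cut[where t = l] assms al that by auto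
  have low: "?I r = a r" if "l < r" "r \<le> K" for r
  proof (rule sorted_local[where q = l])
    show "1 \<le> a i" if "i \<in> {1..l}" for i using p(2)[of i] that assms by auto
    show "a i \<le> 1" if "i \<in> {Suc l..K}" for i using p(2)[of i] that assms by force
  qed (use assms that in auto)
  have hi1: "?I r > 1" if "1 \<le> r" "r \<le> l" for r
    using high[OF that] p0 al anti[of r l] that assms by simp
  have lo1: "?I r \<le> 1" if "l < r" "r \<le> K" for r
    using low[OF that] p(2)[of r] that assms by force
  have "?I r > 1 \<longleftrightarrow> r \<le> l" if "r \<in> {1..K}" for r
    using hi1[of r] lo1[of r] that by fastforce
  then have "{r\<in>{1..K}. ?I r > 1} \<in> Psi_between K l u" using assms by (intro segment_in_Psi) auto
  moreover have "(\<forall>r\<in>{1..K}. ?I r \<notin> {1/A<..<B}) \<longleftrightarrow> a l / a (Suc l) \<ge> B \<and> a (Suc l) \<le> 1/A"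
  proof
    assume "\<forall>r\<in>{1..K}. ?I r \<notin> {1/A<..<B}"
    then have "?I l \<notin> {1/A<..<B}" "?I (Suc l) \<notin> {1/A<..<B}" using assms by auto
    then show "a l / a (Suc l) \<ge> B \<and> a (Suc l) \<le> 1/A"
      using above_threshold[of "?I l"] below_threshold[of "?I (Suc l)"] hi1[of l] lo1[of "Suc l"]
        high[of l] low[of "Suc l"] assms by auto
  next
    assume *: "a l / a (Suc l) \<ge> B \<and> a (Suc l) \<le> 1/A"
    show "\<forall>r\<in>{1..K}. ?I r \<notin> {1/A<..<B}"
    proof
      fix r assume r: "r \<in> {1..K}"
      show "?I r \<notin> {1/A<..<B}"
      proof (cases "r \<le> l")
        case True
        have "a l / a (Suc l) \<le> a r / a (Suc l)"
          using p0 anti[of r l] r True assms by (simp add: divide_right_mono)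
        then show ?thesis using * high[of r] r True by auto
      next
        case False
        then show ?thesis using * low[of r] r anti[of "Suc l" r] by auto
      qed
    qed
  qed
  ultimately show ?thesis using p0 AB by (auto simp: stops_def field_simps)
qed

text \<open>
  Both bounds are slack, or vacuous: for \<open>p = u = K\<close> there is no further unit to add.
\<close>

lemma stops_inside:
  assumes "l < p" "p < u \<or> p = u \<and> u = K"
  shows "stops K (Psi_between K l u) A B (iso_ratio (Psi_between K l u) a) \<longleftrightarrow>
    (\<forall>r\<in>{1..K}. a r \<notin> {1/A<..<B})" (is "stops _ _ _ _ ?I \<longleftrightarrow> _")
proof -
  have I: "?I r = a r" if "r \<in> {1..K}" for r
  proof (rule sorted_local[where q = p])
    show "1 \<le> a i" if "i \<in> {1..p}" for i using p(1) p(2)[of i] that by auto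
    show "a i \<le> 1" if "i \<in> {Suc p..K}" for i using p(2)[of i] that by force
  qed (use assms p that in auto)
  have "{r\<in>{1..K}. ?I r > 1} \<in> Psi_between K l u"
    using assms p by (intro segment_in_Psi[where t = p]) (auto simp: I)
  then show ?thesis by (auto simp: stops_def I)
qed

text \<open>
  Exactly \<open>u\<close> values exceed 1: removing one of them is free because \<open>l < u\<close>, whereas a further
  unit has to displace rank \<open>u\<close>. The selected set is always the top \<open>u\<close>.
\<close>

lemma stops_at_upper:
  assumes "l < u" "u < K" "p = u"
  shows "stops K (Psi_between K l u) A B (iso_ratio (Psi_between K l u) a) \<longleftrightarrow>
    a u \<ge> max B (A * a (Suc u))" (is "stops _ _ _ _ ?I \<longleftrightarrow> _")
proof -
  have au: "a u > 1" "a (Suc u) \<le> 1" using p(2)[of u] p(2)[of "Suc u"] assms by auto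
  have p0: "a (Suc u) > 0" using pos assms by auto
  have high: "?I r = a r" if "1 \<le> r" "r \<le> u" for r
  proof (rule sorted_local[where q = u])
    show "1 \<le> a i" if "i \<in> {1..u}" for i using p(2)[of i] that assms by auto
    show "a i \<le> 1" if "i \<in> {Suc u..K}" for i using p(2)[of i] that assms by force
  qed (use assms that in auto)
  have low: "?I r = a r / a u" if "u < r" "r \<le> K" for r
    using sorted_below_cut[where t = u] assms au that by auto
  have hi1: "?I r > 1" if "1 \<le> r" "r \<le> u" for r
    using high[OF that] p(2)[of r] that assms by force
  have lo1: "?I r \<le> 1" if "u < r" "r \<le> K" for r
    using low[OF that] au anti[of u r] that assms by simp
  have "?I r > 1 \<longleftrightarrow> r \<le> u" if "r \<in> {1..K}" for r
    using hi1[of r] lo1[of r] that by fastforce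
  then have "{r\<in>{1..K}. ?I r > 1} \<in> Psi_between K l u" using assms by (intro segment_in_Psi) auto
  moreover have "(\<forall>r\<in>{1..K}. ?I r \<notin> {1/A<..<B}) \<longleftrightarrow> a u \<ge> B \<and> a (Suc u) / a u \<le> 1/A"
  proof
    assume "\<forall>r\<in>{1..K}. ?I r \<notin> {1/A<..<B}"
    then have "?I u \<notin> {1/A<..<B}" "?I (Suc u) \<notin> {1/A<..<B}" using assms by auto
    then show "a u \<ge> B \<and> a (Suc u) / a u \<le> 1/A"
      using above_threshold[of "?I u"] below_threshold[of "?I (Suc u)"] hi1[of u] lo1[of "Suc u"]
        high[of u] low[of "Suc u"] assms by auto
  next
    assume *: "a u \<ge> B \<and> a (Suc u) / a u \<le> 1/A"
    show "\<forall>r\<in>{1..K}. ?I r \<notin> {1/A<..<B}"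
    proof
      fix r assume r: "r \<in> {1..K}"
      show "?I r \<notin> {1/A<..<B}"
      proof (cases "r \<le> u")
        case True
        then show ?thesis using * high[of r] r anti[of r u] assms by auto
      next
        case False
        have "a r / a u \<le> a (Suc u) / a u"
          using au anti[of "Suc u" r] r False by (simp add: divide_right_mono)
        then show ?thesis using * low[of r] r False by auto
      qed
    qed
  qed
  ultimately show ?thesis using au AB by (auto simp: stops_def field_simps)
qed

lemma stops_below_lower:
  assumes "1 \<le> l" "l < K" "l \<le> u" "p < l"
  shows "stops K (Psi_between K l u) A B (iso_ratio (Psi_between K l u) a) \<longleftrightarrow>
    a l \<ge> a (Suc l) * max A B"
proof (rule stops_at_active_cut)
  show "l = u \<or> a l \<le> 1" using p(2)[of l] assms by force
qed (use assms in auto)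

lemma stops_above_upper:
  assumes "1 \<le> u" "l \<le> u" "u < p"
  shows "stops K (Psi_between K l u) A B (iso_ratio (Psi_between K l u) a) \<longleftrightarrow>
    a u \<ge> a (Suc u) * max A B"
proof (rule stops_at_active_cut)
  show "u = l \<or> a (Suc u) \<ge> 1" using p(1) p(2)[of "Suc u"] assms by force
qed (use assms p in auto)

end
end

section \<open>The stopping rule for unranked statistics\<close>

lemma Psi_between_reindex:
  assumes "bij_betw \<sigma> {1..K} {1..K}" "r \<in> {1..K}"
  shows "{A\<in>Psi_between K l u. \<sigma> r \<in> A} = image \<sigma> ` {A\<in>Psi_between K l u. r \<in> A}"
    and "{A\<in>Psi_between K l u. \<sigma> r \<notin> A} = image \<sigma> ` {A\<in>Psi_between K l u. r \<notin> A}"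
proof -
  have inj: "inj_on \<sigma> {1..K}" and im: "\<sigma> ` {1..K} = {1..K}"
    using assms by (auto simp: bij_betw_def)
  have mem: "\<sigma> r \<in> \<sigma> ` A \<longleftrightarrow> r \<in> A" if "A \<subseteq> {1..K}" for A
    using inj assms(2) that by (auto dest: inj_onD)
  have Psi: "\<sigma> ` A \<in> Psi_between K l u \<longleftrightarrow> A \<in> Psi_between K l u" if "A \<subseteq> {1..K}" for A
    using that im card_image[OF inj_on_subset[OF inj that]] by (auto simp: Psi_between_def)
  have ex: "\<exists>A'\<subseteq>{1..K}. A = \<sigma> ` A'" if "A \<in> Psi_between K l u" for A
    using that im by (metis (no_types, lifting) Psi_between_def mem_Collect_eq subset_image_iff)
  have sub: "A \<subseteq> {1..K}" if "A \<in> Psi_between K l u" for A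
    using that by (auto simp: Psi_between_def)
  show "{A\<in>Psi_between K l u. \<sigma> r \<in> A} = image \<sigma> ` {A\<in>Psi_between K l u. r \<in> A}"
  proof (intro set_eqI iffI)
    fix A assume "A \<in> {A\<in>Psi_between K l u. \<sigma> r \<in> A}"
    then show "A \<in> image \<sigma> ` {A\<in>Psi_between K l u. r \<in> A}" using ex[of A] Psi mem by auto
  next
    fix A assume "A \<in> image \<sigma> ` {A\<in>Psi_between K l u. r \<in> A}"
    then show "A \<in> {A\<in>Psi_between K l u. \<sigma> r \<in> A}" using Psi mem sub by auto
  qed
  show "{A\<in>Psi_between K l u. \<sigma> r \<notin> A} = image \<sigma> ` {A\<in>Psi_between K l u. r \<notin> A}"
  proof (intro set_eqI iffI)
    fix A assume "A \<in> {A\<in>Psi_between K l u. \<sigma> r \<notin> A}"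
    then show "A \<in> image \<sigma> ` {A\<in>Psi_between K l u. r \<notin> A}" using ex[of A] Psi mem by auto
  next
    fix A assume "A \<in> image \<sigma> ` {A\<in>Psi_between K l u. r \<notin> A}"
    then show "A \<in> {A\<in>Psi_between K l u. \<sigma> r \<notin> A}" using Psi mem sub by auto
  qed
qed

lemma iso_ratio_reindex:
  assumes "bij_betw \<sigma> {1..K} {1..K}" "r \<in> {1..K}"
  shows "iso_ratio (Psi_between K l u) L (\<sigma> r) = iso_ratio (Psi_between K l u) (\<lambda>i. L (\<sigma> i)) r"
proof -
  have inj: "inj_on \<sigma> {1..K}" using assms by (auto simp: bij_betw_def)
  have "prod L (\<sigma> ` A) = prod (\<lambda>i. L (\<sigma> i)) A" if "A \<in> Psi_between K l u" for A
    using that inj_on_subset[OF inj, of A] by (simp add: Psi_between_def prod.reindex)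
  then show ?thesis
    by (simp add: iso_ratio_def Psi_between_reindex[OF assms] image_image cong: image_cong_simp)
qed

text \<open>
  Tied statistics admit several rankings; any of them will do, since only the values at each rank
  matter.
\<close>

lemma ex_sorting:
  "\<exists>\<sigma>. bij_betw \<sigma> {1..K} {1..K} \<and> (\<forall>i\<in>{1..K}. ordered K L i = L (\<sigma> i)) \<and>
    (\<forall>i j. 1 \<le> i \<longrightarrow> i \<le> j \<longrightarrow> j \<le> K \<longrightarrow> L (\<sigma> j) \<le> L (\<sigma> i))"
proof -
  define ys where "ys = rev (sort_key L [1..<Suc K])"
  have len: "length ys = K" and dist: "distinct ys" and set: "set ys = {1..K}"
    by (auto simp: ys_def)
  have eq: "rev (sort (map L [1..<Suc K])) = map L ys"
  proof -
    have "sort (map L [1..<Suc K]) = map L (sort_key L [1..<Suc K])"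
      by (rule properties_for_sort) (auto)
    then show ?thesis by (simp add: ys_def rev_map)
  qed
  have srt: "sorted (rev (map L ys))" by (simp add: ys_def rev_map)
  define \<sigma> where "\<sigma> i = ys ! (i - 1)" for i
  have "bij_betw (\<lambda>i. i - 1) {1..K} {..<K}"
    by (rule bij_betwI[where g = Suc]) auto
  moreover have "bij_betw (\<lambda>i. ys ! i) {..<K} {1..K}"
    using bij_betw_nth[OF dist] len set by auto
  ultimately have bij: "bij_betw \<sigma> {1..K} {1..K}"
    using bij_betw_trans unfolding \<sigma>_def comp_def by fastforce
  have ord: "ordered K L i = L (\<sigma> i)" if "i \<in> {1..K}" for i
    unfolding ordered_def eq \<sigma>_def using that len by (intro nth_map) auto
  have mono: "L (\<sigma> j) \<le> L (\<sigma> i)" if "1 \<le> i" "i \<le> j" "j \<le> K" for i j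
    using sorted_rev_nth_mono[OF srt, of "i - 1" "j - 1"] that len by (simp add: \<sigma>_def)
  show ?thesis using bij ord mono by blast
qed

lemma stops_reindex:
  assumes "bij_betw \<sigma> {1..K} {1..K}"
  shows "stops K (Psi_between K l u) A B (\<lambda>i. I (\<sigma> i)) \<longleftrightarrow> stops K (Psi_between K l u) A B I"
proof -
  have inj: "inj_on \<sigma> {1..K}" and im: "\<sigma> ` {1..K} = {1..K}"
    using assms by (auto simp: bij_betw_def)
  have "{k\<in>{1..K}. I k > 1} = \<sigma> ` {i\<in>{1..K}. I (\<sigma> i) > 1}"
    using Compr_image_eq[of \<sigma> "{1..K}" "\<lambda>k. I k > 1"] unfolding im .
  then have "card {k\<in>{1..K}. I k > 1} = card {i\<in>{1..K}. I (\<sigma> i) > 1}"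
    using inj by (metis (no_types, lifting) card_image inj_on_subset mem_Collect_eq subsetI)
  moreover have "(\<forall>k\<in>{1..K}. I k \<notin> {1/A<..<B}) \<longleftrightarrow> (\<forall>i\<in>{1..K}. I (\<sigma> i) \<notin> {1/A<..<B})"
    using im by (metis (no_types, lifting) imageE imageI)
  ultimately show ?thesis by (auto simp: stops_def Psi_between_def)
qed

lemma initial_segment:
  assumes "D \<subseteq> {1..K}" "\<And>i j. 1 \<le> i \<Longrightarrow> i \<le> j \<Longrightarrow> j \<in> D \<Longrightarrow> i \<in> D"
  shows "D = {1..card D}"
proof (cases "D = {}")
  case False
  have fin: "finite D" using assms(1) finite_subset by blast
  have "D = {1..Max D}"
    using assms Max_in[OF fin False] Max_ge[OF fin] by fastforce
  then show ?thesis by (metis card_atLeastAtMost diff_Suc_1)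
qed simp

text \<open>
  Ranking the units permutes the isolation statistics along with the local ones, so the results for
  ranked values apply, with a case distinction on the number \<open>p\<close> of values above 1.
\<close>

lemma stops_iff_ordered:
  assumes AB: "A > 1" "B > 1" and l: "1 \<le> l"
    and pos: "\<And>k. k \<in> {1..K} \<Longrightarrow> L k > 0"
  shows stops_iff_fixed_size:
    "\<lbrakk>l = u; u < K\<rbrakk> \<Longrightarrow> stops K (Psi_between K l u) A B (iso_ratio (Psi_between K l u) L) \<longleftrightarrow>
      ordered K L u \<ge> ordered K L (u + 1) * max A B"
    and stops_iff_two_bounds:
    "\<lbrakk>l < u; u < K\<rbrakk> \<Longrightarrow> stops K (Psi_between K l u) A B (iso_ratio (Psi_between K l u) L) \<longleftrightarrow>
      (num_above K L < l \<and> ordered K L l \<ge> ordered K L (l + 1) * max A B) \<or>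
      (num_above K L = l \<and> ordered K L (l + 1) \<le> min (1/A) (ordered K L l / B)) \<or>
      (l < num_above K L \<and> num_above K L < u \<and> (\<forall>k\<in>{1..K}. L k \<notin> {1/A<..<B})) \<or>
      (num_above K L = u \<and> ordered K L u \<ge> max B (A * ordered K L (u + 1))) \<or>
      (num_above K L > u \<and> ordered K L u \<ge> ordered K L (u + 1) * max A B)"
    and stops_iff_lower_bound:
    "\<lbrakk>l < u; u = K\<rbrakk> \<Longrightarrow> stops K (Psi_between K l u) A B (iso_ratio (Psi_between K l u) L) \<longleftrightarrow>
      (num_above K L < l \<and> ordered K L l \<ge> ordered K L (l + 1) * max A B) \<or>
      (num_above K L = l \<and> ordered K L (l + 1) \<le> min (1/A) (ordered K L l / B)) \<or>
      (num_above K L > l \<and> (\<forall>k\<in>{1..K}. L k \<notin> {1/A<..<B}))"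
proof -
  obtain \<sigma> where bij: "bij_betw \<sigma> {1..K} {1..K}"
    and ord: "\<And>i. i \<in> {1..K} \<Longrightarrow> ordered K L i = L (\<sigma> i)"
    and anti: "\<And>i j. 1 \<le> i \<Longrightarrow> i \<le> j \<Longrightarrow> j \<le> K \<Longrightarrow> L (\<sigma> j) \<le> L (\<sigma> i)"
    using ex_sorting[of K L] by blast
  have inj: "inj_on \<sigma> {1..K}" and im: "\<sigma> ` {1..K} = {1..K}"
    using bij by (auto simp: bij_betw_def)
  define a where "a i = L (\<sigma> i)" for i
  let ?\<Psi> = "Psi_between K l u"
  have apos: "a i > 0" if "i \<in> {1..K}" for i
  proof -
    have "\<sigma> i \<in> {1..K}" using im that by blast
    then show ?thesis unfolding a_def by (rule pos)
  qed
  have aanti: "a j \<le> a i" if "1 \<le> i" "i \<le> j" "j \<le> K" for i j using anti that by (simp add: a_def)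
  have stops: "stops K ?\<Psi> A B (iso_ratio ?\<Psi> L) \<longleftrightarrow> stops K ?\<Psi> A B (iso_ratio ?\<Psi> a)"
  proof -
    have "stops K ?\<Psi> A B (iso_ratio ?\<Psi> L) \<longleftrightarrow> stops K ?\<Psi> A B (\<lambda>i. iso_ratio ?\<Psi> L (\<sigma> i))"
      using stops_reindex[OF bij] by simp
    also have "\<dots> \<longleftrightarrow> stops K ?\<Psi> A B (iso_ratio ?\<Psi> a)"
      unfolding stops_def using iso_ratio_reindex[OF bij, of _ l u L]
      by (simp add: a_def[abs_def] cong: conj_cong)
    finally show ?thesis .
  qed
  define p where "p = num_above K L"
  define D where "D = {i\<in>{1..K}. a i > 1}"
  have "{k\<in>{1..K}. L k > 1} = \<sigma> ` D"
    using Compr_image_eq[of \<sigma> "{1..K}" "\<lambda>k. L k > 1"] unfolding im D_def a_def .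
  then have pD: "p = card D"
    unfolding p_def num_above_def using inj
    by (metis (no_types, lifting) D_def card_image inj_on_subset mem_Collect_eq subsetI)
  have "D = {1..card D}"
  proof (rule initial_segment)
    show "D \<subseteq> {1..K}" by (auto simp: D_def)
    show "i \<in> D" if "1 \<le> i" "i \<le> j" "j \<in> D" for i j
      using that aanti[of i j] by (auto simp: D_def)
  qed
  then have Dp: "D = {1..p}" unfolding pD .
  have "p \<le> K"
  proof -
    have "card D \<le> card {1..K}" by (rule card_mono) (auto simp: D_def)
    then show ?thesis by (simp add: pD)
  qed
  moreover have "a i > 1 \<longleftrightarrow> i \<le> p" if "i \<in> {1..K}" for i
  proof -
    have "i \<in> D \<longleftrightarrow> i \<in> {1..p}" using Dp by simp
    then show ?thesis using that by (simp add: D_def)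
  qed
  ultimately have p: "p \<le> K" "\<And>i. i \<in> {1..K} \<Longrightarrow> a i > 1 \<longleftrightarrow> i \<le> p" by auto
  have all: "(\<forall>k\<in>{1..K}. L k \<notin> {1/A<..<B}) \<longleftrightarrow> (\<forall>i\<in>{1..K}. a i \<notin> {1/A<..<B})"
    unfolding a_def using im by (metis (no_types, lifting) imageE imageI)
  have o: "ordered K L i = a i" if "1 \<le> i" "i \<le> K" for i using ord that by (simp add: a_def)
  show "stops K ?\<Psi> A B (iso_ratio ?\<Psi> L) \<longleftrightarrow> ordered K L u \<ge> ordered K L (u + 1) * max A B"
    if "l = u" "u < K"
    using stops_at_active_cut[where K = K and a = a and t = u and l = l and u = u, OF AB apos aanti] that l
    unfolding stops by (simp add: o)
  show "stops K (Psi_between K l u) A B (iso_ratio (Psi_between K l u) L) \<longleftrightarrow>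
      (num_above K L < l \<and> ordered K L l \<ge> ordered K L (l + 1) * max A B) \<or>
      (num_above K L = l \<and> ordered K L (l + 1) \<le> min (1/A) (ordered K L l / B)) \<or>
      (l < num_above K L \<and> num_above K L < u \<and> (\<forall>k\<in>{1..K}. L k \<notin> {1/A<..<B})) \<or>
      (num_above K L = u \<and> ordered K L u \<ge> max B (A * ordered K L (u + 1))) \<or>
      (num_above K L > u \<and> ordered K L u \<ge> ordered K L (u + 1) * max A B)" if lu: "l < u" "u < K"
  proof -
    consider "p < l" | "p = l" | "l < p" "p < u" | "p = u" | "p > u" by linarith
    then show ?thesis
    proof cases
      case 1
      then show ?thesis using stops_below_lower[where K = K and a = a, OF AB apos aanti p, of l u] lu l
        unfolding stops by (simp add: o flip: p_def)
    next
      case 2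
      then show ?thesis using stops_at_lower[where K = K and a = a, OF AB apos aanti p, of l u] lu l
        unfolding stops by (simp add: o flip: p_def)
    next
      case 3
      then show ?thesis using stops_inside[where K = K and a = a, OF AB apos aanti p, of l u] lu l
        unfolding stops all by (simp flip: p_def)
    next
      case 4
      then show ?thesis using stops_at_upper[where K = K and a = a, OF AB apos aanti p, of l u] lu l
        unfolding stops by (simp add: o flip: p_def)
    next
      case 5
      then show ?thesis using stops_above_upper[where K = K and a = a, OF AB apos aanti p, of u l] lu l
        unfolding stops by (simp add: o flip: p_def)
    qed
  qed
  show "stops K (Psi_between K l u) A B (iso_ratio (Psi_between K l u) L) \<longleftrightarrow>
      (num_above K L < l \<and> ordered K L l \<ge> ordered K L (l + 1) * max A B) \<or>
      (num_above K L = l \<and> ordered K L (l + 1) \<le> min (1/A) (ordered K L l / B)) \<or>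
      (num_above K L > l \<and> (\<forall>k\<in>{1..K}. L k \<notin> {1/A<..<B}))" if lu: "l < u" "u = K"
  proof -
    consider "p < l" | "p = l" | "l < p" by linarith
    then show ?thesis
    proof cases
      case 1
      then show ?thesis using stops_below_lower[where K = K and a = a, OF AB apos aanti p, of l u] lu l
        unfolding stops by (simp add: o flip: p_def)
    next
      case 2
      then show ?thesis using stops_at_lower[where K = K and a = a, OF AB apos aanti p, of l u] lu l
        unfolding stops by (simp add: o flip: p_def)
    next
      case 3
      then have "p < u \<or> p = u \<and> u = K" using p(1) lu by linarith
      then show ?thesis using stops_inside[where K = K and a = a, OF AB apos aanti p, of l u] lu l 3
        unfolding stops all by (simp flip: p_def)
    qed
  qed
qed

section \<open>Maximising a product over independent choices\<close>

text \<open>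
  Maximising over the pairs of a set \<open>A\<close> and a choice of marginals factorises: for fixed \<open>A\<close> each
  coordinate is maximised separately, and what remains depends on \<open>A\<close> through the ratios of
  the coordinatewise maxima. Completeness of the family makes the bound attained.
\<close>

lemma Max_prod_choice:
  fixes lam :: "nat \<Rightarrow> 'b \<Rightarrow> real" and m :: "'p \<Rightarrow> nat \<Rightarrow> 'b"
  assumes J: "finite J" and F: "finite \<F>" and \<A>: "finite \<A>" "\<A> \<noteq> {}" "\<And>A. A \<in> \<A> \<Longrightarrow> A \<subseteq> J"
    and HG: "\<And>j. j \<in> J \<Longrightarrow> finite (H j) \<and> H j \<noteq> {} \<and> finite (G j) \<and> G j \<noteq> {}"
    and pos: "\<And>j q. j \<in> J \<Longrightarrow> q \<in> H j \<union> G j \<Longrightarrow> lam j q > 0"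
    and c: "c > 0" and f: "\<And>P. P \<in> \<F> \<Longrightarrow> f P = c * (\<Prod>j\<in>J. lam j (m P j))"
    and sound: "\<And>P. P \<in> \<F> \<Longrightarrow> \<exists>A\<in>\<A>. \<forall>j\<in>J. m P j \<in> (if j \<in> A then G j else H j)"
    and complete: "\<And>A q. A \<in> \<A> \<Longrightarrow> (\<And>j. j \<in> J \<Longrightarrow> q j \<in> (if j \<in> A then G j else H j)) \<Longrightarrow>
      \<exists>P\<in>\<F>. \<forall>j\<in>J. m P j = q j"
  shows "Max (f ` \<F>) = c * (\<Prod>j\<in>J. Max (lam j ` H j)) *
    Max (prod (\<lambda>j. Max (lam j ` G j) / Max (lam j ` H j)) ` \<A>)"
proof (rule Max_eqI)
  define gm where "gm j = Max (lam j ` G j)" for j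
  define hm where "hm j = Max (lam j ` H j)" for j
  have hm: "hm j > 0" "\<And>q. q \<in> H j \<Longrightarrow> lam j q \<le> hm j" "hm j \<in> lam j ` H j"
    and gm: "gm j > 0" "\<And>q. q \<in> G j \<Longrightarrow> lam j q \<le> gm j" "gm j \<in> lam j ` G j" if "j \<in> J" for j
  proof -
    show h: "hm j \<in> lam j ` H j" and g: "gm j \<in> lam j ` G j"
      unfolding hm_def gm_def using HG[OF that] by (auto intro!: Max_in)
    show "hm j > 0" "gm j > 0" using h g pos[OF that] by auto
    show "lam j q \<le> hm j" if "q \<in> H j" for q unfolding hm_def using that HG[OF \<open>j \<in> J\<close>] by auto
    show "lam j q \<le> gm j" if "q \<in> G j" for q unfolding gm_def using that HG[OF \<open>j \<in> J\<close>] by auto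
  qed
  let ?L = "\<lambda>j. gm j / hm j"
  have split: "(\<Prod>j\<in>J. if j \<in> A then gm j else hm j) = (\<Prod>j\<in>J. hm j) * prod ?L A" if "A \<in> \<A>" for A
  proof -
    have "(\<Prod>j\<in>J. if j \<in> A then gm j else hm j) = (\<Prod>j\<in>J. hm j * (if j \<in> A then ?L j else 1))"
      using hm(1) by (intro prod.cong) (auto simp: less_imp_neq[symmetric])
    also have "\<dots> = (\<Prod>j\<in>J. hm j) * (\<Prod>j\<in>J. if j \<in> A then ?L j else 1)" by (rule prod.distrib)
    also have "(\<Prod>j\<in>J. if j \<in> A then ?L j else 1) = prod ?L (J \<inter> A)"
      using J by (rule prod.inter_restrict[symmetric])
    also have "J \<inter> A = A" using \<A>(3)[OF that] by auto
    finally show ?thesis .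
  qed
  have hpos: "(\<Prod>j\<in>J. hm j) > 0" using hm(1) by (intro prod_pos) auto
  show "finite (f ` \<F>)" using F by simp
  show "y \<le> c * (\<Prod>j\<in>J. Max (lam j ` H j)) * Max (prod (\<lambda>j. Max (lam j ` G j) / Max (lam j ` H j)) ` \<A>)"
    if "y \<in> f ` \<F>" for y
  proof -
    obtain P where P: "P \<in> \<F>" "y = f P" using \<open>y \<in> f ` \<F>\<close> by auto
    obtain A where A: "A \<in> \<A>" "\<And>j. j \<in> J \<Longrightarrow> m P j \<in> (if j \<in> A then G j else H j)"
      using sound[OF P(1)] by auto
    have "(\<Prod>j\<in>J. lam j (m P j)) \<le> (\<Prod>j\<in>J. if j \<in> A then gm j else hm j)"
    proof (rule prod_mono)
      fix j assume j: "j \<in> J"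
      have "m P j \<in> H j \<union> G j" using A(2)[OF j] by (auto split: if_splits)
      then have "0 \<le> lam j (m P j)" using pos[OF j] by (simp add: less_imp_le)
      then show "0 \<le> lam j (m P j) \<and> lam j (m P j) \<le> (if j \<in> A then gm j else hm j)"
        using A(2)[OF j] gm(2)[OF j] hm(2)[OF j] by auto
    qed
    also have "\<dots> = (\<Prod>j\<in>J. hm j) * prod ?L A" by (rule split[OF A(1)])
    also have "\<dots> \<le> (\<Prod>j\<in>J. hm j) * Max (prod ?L ` \<A>)"
      using hpos \<A> A(1) by (intro mult_left_mono Max_ge) auto
    finally show ?thesis using c unfolding P(2) f[OF P(1)] hm_def gm_def by (simp add: mult.assoc)
  qed
  show "c * (\<Prod>j\<in>J. Max (lam j ` H j)) * Max (prod (\<lambda>j. Max (lam j ` G j) / Max (lam j ` H j)) ` \<A>) \<in> f ` \<F>"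
  proof -
    have "Max (prod ?L ` \<A>) \<in> prod ?L ` \<A>" using \<A> by (intro Max_in) auto
    then obtain A where A: "A \<in> \<A>" "Max (prod ?L ` \<A>) = prod ?L A" by auto
    have "\<exists>q. \<forall>j\<in>J. q j \<in> (if j \<in> A then G j else H j) \<and> lam j (q j) = (if j \<in> A then gm j else hm j)"
      by (rule bchoice) (use gm(3) hm(3) in fastforce)
    then obtain q where q: "\<And>j. j \<in> J \<Longrightarrow> q j \<in> (if j \<in> A then G j else H j)"
      "\<And>j. j \<in> J \<Longrightarrow> lam j (q j) = (if j \<in> A then gm j else hm j)" by blast
    obtain P where P: "P \<in> \<F>" "\<forall>j\<in>J. m P j = q j" using complete[OF A(1) q(1)] by auto
    have "f P = c * (\<Prod>j\<in>J. if j \<in> A then gm j else hm j)"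
      using P q(2) by (simp add: f)
    also have "\<dots> = c * (\<Prod>j\<in>J. hm j) * Max (prod ?L ` \<A>)" by (simp add: split[OF A(1)] A(2))
    finally show ?thesis using P(1) unfolding hm_def gm_def by (metis imageI)
  qed
qed

section \<open>Product laws on the first observations\<close>

lemma measurable_coordinate:
  assumes "k \<in> s" "1 \<le> m"
  shows "(\<lambda>x. x k m) \<in> path_space S s \<rightarrow>\<^sub>M S k m"
proof -
  have "(\<lambda>x. x k) \<in> path_space S s \<rightarrow>\<^sub>M source_space S k"
    unfolding path_space_def by (rule measurable_component_singleton[OF assms(1)])
  moreover have "(\<lambda>y. y m) \<in> source_space S k \<rightarrow>\<^sub>M S k m"
    unfolding source_space_def by (rule measurable_component_singleton) (use assms in auto)
  ultimately show ?thesis by (rule measurable_compose)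
qed

lemma measurable_first_obs:
  "(\<lambda>x. \<lambda>k\<in>s. \<lambda>m\<in>{1..n}. x k m) \<in> path_space S s \<rightarrow>\<^sub>M (\<Pi>\<^sub>M k\<in>s. \<Pi>\<^sub>M m\<in>{1..n}. S k m)"
  by (intro measurable_restrict measurable_coordinate) auto

lemma space_obs_sigma [simp]: "space (obs_sigma S s n) = space (path_space S s)"
  by (simp add: obs_sigma_def)

lemma subalgebra_obs_sigma:
  assumes "sets P = sets (path_space S s)"
  shows "subalgebra P (obs_sigma S s n)"
proof -
  have sp: "space P = space (path_space S s)" using assms by (rule sets_eq_imp_space_eq)
  have "sets (obs_sigma S s n) \<subseteq> sets (path_space S s)"
    unfolding obs_sigma_def by (rule sets_image_in_sets[OF refl measurable_first_obs])
  then show ?thesis using assms sp by (simp add: subalgebra_def)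
qed

lemma sets_law_on:
  assumes "sets P = sets (path_space S s)"
  shows "sets (law_on S s n P) = sets (obs_sigma S s n)"
  unfolding law_on_def by (rule sets_restr_to_subalg[OF subalgebra_obs_sigma[OF assms]])

lemma prob_space_law_on:
  assumes "prob_space P" "sets P = sets (path_space S s)"
  shows "prob_space (law_on S s n P)"
  unfolding law_on_def by (rule prob_space_restr_to_subalg[OF subalgebra_obs_sigma[OF assms(2)] assms(1)])

lemma measurable_law_on:
  assumes "sets P = sets (path_space S s)" "f \<in> obs_sigma S s n \<rightarrow>\<^sub>M N"
  shows "f \<in> law_on S s n P \<rightarrow>\<^sub>M N"
  using assms(2) by (simp add: measurable_cong_sets[OF sets_law_on[OF assms(1)] refl])

lemma AE_law_onD:
  assumes "sets P = sets (path_space S s)" "AE x in law_on S s n P. Q x"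
  shows "AE x in P. Q x"
  using AE_restr_to_subalg[OF subalgebra_obs_sigma[OF assms(1)]] assms(2) unfolding law_on_def .

lemma measurable_restrict_obs_sigma:
  assumes "k \<in> s"
  shows "(\<lambda>x. restrict x {k}) \<in> obs_sigma S s n \<rightarrow>\<^sub>M obs_sigma S {k} n"
  unfolding obs_sigma_def[of S "{k}"]
proof (rule measurable_vimage_algebra2)
  show "(\<lambda>x. restrict x {k}) \<in> space (obs_sigma S s n) \<rightarrow> space (path_space S {k})"
    using assms by (auto simp: path_space_def space_PiM)
  have "(\<lambda>x. \<lambda>j\<in>s. \<lambda>m\<in>{1..n}. x j m) \<in> obs_sigma S s n \<rightarrow>\<^sub>M (\<Pi>\<^sub>M k\<in>s. \<Pi>\<^sub>M m\<in>{1..n}. S k m)"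
    unfolding obs_sigma_def
    using measurable_space[OF measurable_first_obs] by (intro measurable_vimage_algebra1) blast
  then have "(\<lambda>x. restrict (\<lambda>j\<in>s. \<lambda>m\<in>{1..n}. x j m) {k}) \<in>
      obs_sigma S s n \<rightarrow>\<^sub>M (\<Pi>\<^sub>M k\<in>{k}. \<Pi>\<^sub>M m\<in>{1..n}. S k m)"
    by (rule measurable_compose[OF _ measurable_restrict_subset]) (use assms in auto)
  moreover have "restrict (\<lambda>j\<in>s. \<lambda>m\<in>{1..n}. x j m) {k}
      = (\<lambda>j\<in>{k}. \<lambda>m\<in>{1..n}. restrict x {k} j m)" for x :: "nat \<Rightarrow> nat \<Rightarrow> 'a"
    using assms by (auto simp: fun_eq_iff restrict_def)
  ultimately show "(\<lambda>x. \<lambda>j\<in>{k}. \<lambda>m\<in>{1..n}. restrict x {k} j m) \<in>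
      obs_sigma S s n \<rightarrow>\<^sub>M (\<Pi>\<^sub>M k\<in>{k}. \<Pi>\<^sub>M m\<in>{1..n}. S k m)"
    by simp
qed

text \<open>
  The sigma-algebra of the first observations is pulled back from a finite product, so measures on
  it are determined by their images there, and these by rectangles with one side per source.
\<close>

lemma measure_eqI_obs_rectangles:
  assumes s: "finite s"
    and sets: "sets \<mu> = sets (obs_sigma S s n)" "sets \<nu> = sets (obs_sigma S s n)"
    and fin: "finite_measure \<mu>"
    and eq: "\<And>B. (\<And>k. k \<in> s \<Longrightarrow> B k \<in> sets (\<Pi>\<^sub>M m\<in>{1..n}. S k m)) \<Longrightarrow>
      emeasure \<mu> {x\<in>space (path_space S s). \<forall>k\<in>s. (\<lambda>m\<in>{1..n}. x k m) \<in> B k} =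
      emeasure \<nu> {x\<in>space (path_space S s). \<forall>k\<in>s. (\<lambda>m\<in>{1..n}. x k m) \<in> B k}"
  shows "\<mu> = \<nu>"
proof -
  let ?X = "space (path_space S s)"
  let ?g = "\<lambda>x. \<lambda>k\<in>s. \<lambda>m\<in>{1..n}. x k m"
  let ?M = "\<lambda>k. \<Pi>\<^sub>M m\<in>{1..n}. S k m"
  interpret finite_measure \<mu> by (rule fin)
  have sp: "space \<mu> = ?X" "space \<nu> = ?X"
    using sets[THEN sets_eq_imp_space_eq] by simp_all
  have g: "?g \<in> obs_sigma S s n \<rightarrow>\<^sub>M PiM s ?M"
    unfolding obs_sigma_def
    using measurable_space[OF measurable_first_obs] by (intro measurable_vimage_algebra1) blast
  have g': "?g \<in> \<mu> \<rightarrow>\<^sub>M PiM s ?M" "?g \<in> \<nu> \<rightarrow>\<^sub>M PiM s ?M"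
    using g by (simp_all add: measurable_cong_sets[OF sets(1) refl] measurable_cong_sets[OF sets(2) refl])
  have dist: "distr \<mu> (PiM s ?M) ?g = distr \<nu> (PiM s ?M) ?g"
  proof (rule measure_eqI_PiM_finite[OF s])
    fix B assume B: "\<And>k. k \<in> s \<Longrightarrow> B k \<in> sets (?M k)"
    have pre: "?g -` (Pi\<^sub>E s B) \<inter> ?X = {x\<in>?X. \<forall>k\<in>s. (\<lambda>m\<in>{1..n}. x k m) \<in> B k}"
      by (auto simp: PiE_iff)
    have "Pi\<^sub>E s B \<in> sets (PiM s ?M)" using B s by (intro sets_PiM_I_finite) auto
    then show "emeasure (distr \<mu> (PiM s ?M) ?g) (Pi\<^sub>E s B) = emeasure (distr \<nu> (PiM s ?M) ?g) (Pi\<^sub>E s B)"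
      using g' eq[OF B] by (simp add: emeasure_distr sp pre del: One_nat_def)
  next
    show "range (\<lambda>i::nat. \<Pi>\<^sub>E k\<in>s. space (?M k)) \<subseteq> prod_algebra s ?M"
      using s by (auto intro!: prod_algebraI_finite)
    show "(\<Union>i::nat. \<Pi>\<^sub>E k\<in>s. space (?M k)) = space (PiM s ?M)" by (simp add: space_PiM)
    show "emeasure (distr \<mu> (PiM s ?M) ?g) (\<Pi>\<^sub>E k\<in>s. space (?M k)) \<noteq> \<infinity>"
      using finite_measure.emeasure_finite[OF finite_measure_distr[OF g'(1)]] by simp
  qed simp_all
  show ?thesis
  proof (rule measure_eqI)
    show "sets \<mu> = sets \<nu>" using sets by simp
    fix Y assume "Y \<in> sets \<mu>"
    then obtain C where C: "C \<in> sets (PiM s ?M)" "Y = ?g -` C \<inter> ?X"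
      using sets(1) measurable_space[OF measurable_first_obs, of _ S s n]
      unfolding obs_sigma_def by (subst (asm) sets_vimage_algebra2) auto
    have "emeasure \<mu> Y = emeasure (distr \<mu> (PiM s ?M) ?g) C"
      using C g' by (simp add: emeasure_distr sp)
    also have "\<dots> = emeasure (distr \<nu> (PiM s ?M) ?g) C" by (simp only: dist)
    also have "\<dots> = emeasure \<nu> Y" using C g' by (simp add: emeasure_distr sp)
    finally show "emeasure \<mu> Y = emeasure \<nu> Y" .
  qed
qed

definition source_laws ::
  "nat \<Rightarrow> (nat \<Rightarrow> nat \<Rightarrow> 'a measure) \<Rightarrow> (nat \<Rightarrow> (nat \<Rightarrow> nat \<Rightarrow> 'a) measure) \<Rightarrow> bool" where
  "source_laws K S q \<longleftrightarrow>
     (\<forall>k\<in>{1..K}. prob_space (q k) \<and> sets (q k) = sets (path_space S {k}))"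

text \<open>
  The law of independent sources with marginals \<open>q\<close>; \<open>independent_sources\<close> says that a law is of
  this form for its own marginals.
\<close>

definition product_law ::
  "nat \<Rightarrow> (nat \<Rightarrow> nat \<Rightarrow> 'a measure) \<Rightarrow> (nat \<Rightarrow> (nat \<Rightarrow> nat \<Rightarrow> 'a) measure)
    \<Rightarrow> (nat \<Rightarrow> nat \<Rightarrow> 'a) measure" where
  "product_law K S q = (\<Pi>\<^sub>M k\<in>{1..K}. distr (q k) (source_space S k) (\<lambda>x. x k))"

lemma sets_product_law [simp]: "sets (product_law K S q) = sets (path_space S {1..K})"
  unfolding product_law_def path_space_def by (rule sets_PiM_cong) auto

lemma measurable_source:
  "(\<lambda>x. x k) \<in> path_space S {k} \<rightarrow>\<^sub>M source_space S k"
  unfolding path_space_def by (rule measurable_component_singleton) simp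

lemma prob_space_product_law:
  assumes "source_laws K S q"
  shows "prob_space (product_law K S q)"
  unfolding product_law_def
proof (rule prob_space_PiM)
  fix k assume "k \<in> {1..K}"
  then have q: "prob_space (q k)" "sets (q k) = sets (path_space S {k})"
    using assms by (auto simp: source_laws_def)
  have "(\<lambda>x. x k) \<in> q k \<rightarrow>\<^sub>M source_space S k"
    using measurable_source by (simp add: measurable_cong_sets[OF q(2) refl])
  then show "prob_space (distr (q k) (source_space S k) (\<lambda>x. x k))"
    by (rule prob_space.prob_space_distr[OF q(1)])
qed

text \<open>
  Fubini for functions of separate sources, in the form in which likelihoods of single sources occur:
  as functions on the path space of the subsystem \<open>{k}\<close>.
\<close>

lemma nn_integral_product_law:
  assumes q: "source_laws K S q"
    and f: "\<And>k. k \<in> {1..K} \<Longrightarrow> f k \<in> borel_measurable (path_space S {k})"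
  shows "(\<integral>\<^sup>+x. (\<Prod>k\<in>{1..K}. f k (restrict x {k})) \<partial>product_law K S q) =
    (\<Prod>k\<in>{1..K}. \<integral>\<^sup>+y. f k y \<partial>q k)"
proof -
  have qk: "prob_space (q k)" "sets (q k) = sets (path_space S {k})" if "k \<in> {1..K}" for k
    using q that by (auto simp: source_laws_def)
  \<comment> \<open>The product locale wants sigma-finite factors at all indices, hence a default beyond \<open>K\<close>.\<close>
  define M where "M k = (if k \<in> {1..K} then distr (q k) (source_space S k) (\<lambda>x. x k)
    else count_space {})" for k
  have src: "(\<lambda>x. x k) \<in> q k \<rightarrow>\<^sub>M source_space S k" if "k \<in> {1..K}" for k
    using measurable_source by (simp add: measurable_cong_sets[OF qk(2)[OF that] refl])
  have prod: "product_law K S q = PiM {1..K} M"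
    unfolding product_law_def M_def by (rule PiM_cong) auto
  have "sigma_finite_measure (M k)" for k
  proof (cases "k \<in> {1..K}")
    case True
    interpret prob_space "distr (q k) (source_space S k) (\<lambda>x. x k)"
      by (rule prob_space.prob_space_distr[OF qk(1)[OF True] src[OF True]])
    show ?thesis unfolding M_def using True by simp unfold_locales
  next
    case False
    then show ?thesis by (auto simp: M_def sigma_finite_measure_count_space_finite)
  qed
  then interpret product_sigma_finite M by (simp add: product_sigma_finite_def)
  define h where "h k y = f k (\<lambda>j\<in>{k}. y)" for k and y :: "nat \<Rightarrow> 'a"
  have emb: "(\<lambda>y. \<lambda>j\<in>{k}. y) \<in> source_space S k \<rightarrow>\<^sub>M path_space S {k}" for k
    unfolding path_space_def by (rule measurable_restrict) simp
  have h: "h k \<in> borel_measurable (source_space S k)" if "k \<in> {1..K}" for k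
    unfolding h_def by (rule measurable_compose[OF emb f[OF that]])
  have "restrict x {k} = (\<lambda>j\<in>{k}. x k)" for x :: "nat \<Rightarrow> nat \<Rightarrow> 'a" and k
    by (auto simp: restrict_def fun_eq_iff)
  then have "(\<integral>\<^sup>+x. (\<Prod>k\<in>{1..K}. f k (restrict x {k})) \<partial>product_law K S q)
      = (\<integral>\<^sup>+x. (\<Prod>k\<in>{1..K}. h k (x k)) \<partial>PiM {1..K} M)"
    by (simp add: prod h_def)
  also have "\<dots> = (\<Prod>k\<in>{1..K}. integral\<^sup>N (M k) (h k))"
    by (rule product_nn_integral_prod) (use h in \<open>auto simp: M_def\<close>)
  also have "\<dots> = (\<Prod>k\<in>{1..K}. \<integral>\<^sup>+y. f k y \<partial>q k)"
  proof (rule prod.cong[OF refl])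
    fix k assume k: "k \<in> {1..K}"
    have "integral\<^sup>N (M k) (h k) = (\<integral>\<^sup>+y. h k (y k) \<partial>q k)"
      using k h[OF k] by (simp add: M_def nn_integral_distr[OF src[OF k]])
    also have "\<dots> = (\<integral>\<^sup>+y. f k y \<partial>q k)"
    proof (rule nn_integral_cong)
      fix y assume "y \<in> space (q k)"
      then have "y \<in> space (path_space S {k})"
        using sets_eq_imp_space_eq[OF qk(2)[OF k]] by simp
      then have "(\<lambda>j\<in>{k}. y k) = y"
        by (auto simp: path_space_def space_PiM PiE_iff extensional_def restrict_def fun_eq_iff)
      then show "h k (y k) = f k y" by (simp add: h_def)
    qed
    finally show "integral\<^sup>N (M k) (h k) = (\<integral>\<^sup>+y. f k y \<partial>q k)" .
  qed
  finally show ?thesis .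
qed

lemma nn_integral_law_on:
  assumes "sets P = sets (path_space S s)" "f \<in> borel_measurable (obs_sigma S s n)"
  shows "(\<integral>\<^sup>+x. f x \<partial>law_on S s n P) = (\<integral>\<^sup>+x. f x \<partial>P)"
  unfolding law_on_def by (rule nn_integral_subalgebra2[OF subalgebra_obs_sigma[OF assms(1)] assms(2)])

text \<open>
  On a rectangle, both measures integrate a product of functions of separate sources, so the claim
  follows source by source.
\<close>

lemma law_on_product_law_density:
  assumes q: "source_laws K S q" and r: "source_laws K S r"
    and \<phi>: "\<And>k. k \<in> {1..K} \<Longrightarrow> \<phi> k \<in> borel_measurable (obs_sigma S {k} n)"
    and dens: "\<And>k. k \<in> {1..K} \<Longrightarrow>
      law_on S {k} n (q k) = density (law_on S {k} n (r k)) (\<phi> k)"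
  shows "(\<lambda>x. \<Prod>k\<in>{1..K}. \<phi> k (restrict x {k})) \<in> borel_measurable (obs_sigma S {1..K} n)"
    and "law_on S {1..K} n (product_law K S q) =
      density (law_on S {1..K} n (product_law K S r)) (\<lambda>x. \<Prod>k\<in>{1..K}. \<phi> k (restrict x {k}))"
proof -
  let ?X = "space (path_space S {1..K})"
  let ?\<Phi> = "\<lambda>x. \<Prod>k\<in>{1..K}. \<phi> k (restrict x {k})"
  have comp: "(\<lambda>x. f (restrict x {k})) \<in> borel_measurable (obs_sigma S {1..K} n)"
    if "k \<in> {1..K}" "f \<in> borel_measurable (obs_sigma S {k} n)"
    for k and f :: "(nat \<Rightarrow> nat \<Rightarrow> 'a) \<Rightarrow> ennreal"
    by (rule measurable_compose[OF measurable_restrict_obs_sigma that(2)]) (rule that(1))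
  show \<Phi>: "?\<Phi> \<in> borel_measurable (obs_sigma S {1..K} n)"
    by (intro borel_measurable_prod_ennreal comp \<phi>)
  have up: "f \<in> borel_measurable (path_space S {k})" if "f \<in> borel_measurable (obs_sigma S {k} n)"
    for k and f :: "(nat \<Rightarrow> nat \<Rightarrow> 'a) \<Rightarrow> ennreal"
    using measurable_from_subalg[OF subalgebra_obs_sigma[OF refl] that] .
  have setsq: "sets (q k) = sets (path_space S {k})" and setsr: "sets (r k) = sets (path_space S {k})"
    if "k \<in> {1..K}" for k
    using q r that by (auto simp: source_laws_def)
  show "law_on S {1..K} n (product_law K S q) = density (law_on S {1..K} n (product_law K S r)) ?\<Phi>"
  proof (rule measure_eqI_obs_rectangles)
    show "finite_measure (law_on S {1..K} n (product_law K S q))"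
      by (intro prob_space.finite_measure prob_space_law_on prob_space_product_law q) simp
    fix B :: "nat \<Rightarrow> (nat \<Rightarrow> 'a) set"
    assume B: "\<And>k. k \<in> {1..K} \<Longrightarrow> B k \<in> sets (\<Pi>\<^sub>M m\<in>{1..n}. S k m)"
    let ?E = "{x\<in>?X. \<forall>k\<in>{1..K}. (\<lambda>m\<in>{1..n}. x k m) \<in> B k}"
    \<comment> \<open>The sides of the rectangle, seen on the path spaces of the single sources.\<close>
    define C where "C k = {y\<in>space (path_space S {k}). (\<lambda>m\<in>{1..n}. y k m) \<in> B k}" for k
    have C: "C k \<in> sets (obs_sigma S {k} n)" if k: "k \<in> {1..K}" for k
    proof -
      have "C k = (\<lambda>x. \<lambda>k\<in>{k}. \<lambda>m\<in>{1..n}. x k m) -` (\<Pi>\<^sub>E j\<in>{k}. B j) \<inter> space (path_space S {k})"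
        by (auto simp: C_def PiE_iff)
      then show ?thesis
        unfolding obs_sigma_def using B[OF k]
        by (auto intro!: in_vimage_algebra sets_PiM_I_finite)
    qed
    have ind: "indicator ?E x = (\<Prod>k\<in>{1..K}. indicator (C k) (restrict x {k}) :: ennreal)"
      if "x \<in> ?X" for x
    proof -
      have sp: "restrict x {k} \<in> space (path_space S {k})" if "k \<in> {1..K}" for k
        using \<open>x \<in> ?X\<close> that by (auto simp: path_space_def space_PiM)
      have "restrict x {k} \<in> C k \<longleftrightarrow> (\<lambda>m\<in>{1..n}. x k m) \<in> B k" if "k \<in> {1..K}" for k
        using sp[OF that] by (simp add: C_def)
      then show ?thesis using that by (auto simp: indicator_def prod_zero_iff)
    qed
    have E: "?E \<in> sets (obs_sigma S {1..K} n)"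
    proof -
      have "?E = (\<lambda>x. \<lambda>k\<in>{1..K}. \<lambda>m\<in>{1..n}. x k m) -` (\<Pi>\<^sub>E j\<in>{1..K}. B j) \<inter> ?X"
        by (auto simp: PiE_iff)
      then show ?thesis
        unfolding obs_sigma_def using B
        by (auto intro!: in_vimage_algebra sets_PiM_I_finite)
    qed
    have spX: "space (product_law K S p) = ?X" for p
      using sets_eq_imp_space_eq[OF sets_product_law] .
    have "emeasure (law_on S {1..K} n (product_law K S q)) ?E
        = (\<integral>\<^sup>+x. indicator ?E x \<partial>law_on S {1..K} n (product_law K S q))"
      using E by (simp add: sets_law_on)
    also have "\<dots> = (\<integral>\<^sup>+x. indicator ?E x \<partial>product_law K S q)"
      using E by (intro nn_integral_law_on) auto
    also have "\<dots> = (\<integral>\<^sup>+x. (\<Prod>k\<in>{1..K}. indicator (C k) (restrict x {k})) \<partial>product_law K S q)"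
      using ind by (intro nn_integral_cong) (simp add: spX)
    also have "\<dots> = (\<Prod>k\<in>{1..K}. \<integral>\<^sup>+y. indicator (C k) y \<partial>q k)"
      by (rule nn_integral_product_law[OF q]) (intro up borel_measurable_indicator C)
    also have "\<dots> = (\<Prod>k\<in>{1..K}. \<integral>\<^sup>+y. \<phi> k y * indicator (C k) y \<partial>r k)"
    proof (rule prod.cong[OF refl])
      fix k assume k: "k \<in> {1..K}"
      have "(\<integral>\<^sup>+y. indicator (C k) y \<partial>q k) = (\<integral>\<^sup>+y. indicator (C k) y \<partial>law_on S {k} n (q k))"
        using C[OF k] by (intro nn_integral_law_on[symmetric] setsq k) auto
      also have "\<dots> = emeasure (density (law_on S {k} n (r k)) (\<phi> k)) (C k)"
        unfolding dens[OF k]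
        using C[OF k] by (intro nn_integral_indicator) (simp add: sets_law_on[OF setsr[OF k]])
      also have "\<dots> = (\<integral>\<^sup>+y. \<phi> k y * indicator (C k) y \<partial>law_on S {k} n (r k))"
        using C[OF k] \<phi>[OF k]
        by (intro emeasure_density measurable_law_on) (simp_all add: sets_law_on[OF setsr[OF k]] setsr[OF k])
      also have "\<dots> = (\<integral>\<^sup>+y. \<phi> k y * indicator (C k) y \<partial>r k)"
        using C[OF k] \<phi>[OF k] by (intro nn_integral_law_on setsr k) auto
      finally show "(\<integral>\<^sup>+y. indicator (C k) y \<partial>q k) = (\<integral>\<^sup>+y. \<phi> k y * indicator (C k) y \<partial>r k)" .
    qed
    also have "\<dots> = (\<integral>\<^sup>+x. (\<Prod>k\<in>{1..K}. \<phi> k (restrict x {k}) * indicator (C k) (restrict x {k}))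
        \<partial>product_law K S r)"
      by (rule nn_integral_product_law[OF r, symmetric])
        (intro up borel_measurable_times_ennreal borel_measurable_indicator C \<phi>)
    also have "\<dots> = (\<integral>\<^sup>+x. ?\<Phi> x * indicator ?E x \<partial>product_law K S r)"
      using ind by (intro nn_integral_cong) (simp add: spX prod.distrib)
    also have "\<dots> = (\<integral>\<^sup>+x. ?\<Phi> x * indicator ?E x \<partial>law_on S {1..K} n (product_law K S r))"
      using E \<Phi> by (intro nn_integral_law_on[symmetric]) auto
    also have "\<dots> = emeasure (density (law_on S {1..K} n (product_law K S r)) ?\<Phi>) ?E"
      using E \<Phi>
      by (intro emeasure_density[symmetric] measurable_law_on) (simp_all add: sets_law_on)
    finally show "emeasure (law_on S {1..K} n (product_law K S q)) ?E =
      emeasure (density (law_on S {1..K} n (product_law K S r)) ?\<Phi>) ?E" .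
  qed (simp_all add: sets_law_on)
qed

section \<open>Likelihood ratios of product laws\<close>

lemma AE_RN_deriv_pos_finite:
  assumes M: "prob_space M" and N: "prob_space N" and sets: "sets N = sets M"
    and ac: "absolutely_continuous M N" "absolutely_continuous N M"
  shows "AE x in M. 0 < enn2real (RN_deriv M N x)"
proof -
  interpret M: prob_space M by (rule M)
  interpret N: prob_space N by (rule N)
  have dens: "density M (RN_deriv M N) = N" by (rule M.density_RN_deriv[OF ac(1) sets])
  have "AE x in density M (RN_deriv M N). 0 < RN_deriv M N x"
    by (simp add: AE_density)
  then have "AE x in N. 0 < RN_deriv M N x" by (simp only: dens)
  then have "AE x in M. 0 < RN_deriv M N x"
    by (rule absolutely_continuous_AE[OF sets[symmetric] ac(2)])
  moreover have "AE x in M. RN_deriv M N x \<noteq> \<infinity>"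
    by (rule M.RN_deriv_finite[OF N.sigma_finite_measure_axioms ac(1) sets])
  ultimately show ?thesis
    by eventually_elim (auto simp: enn2real_positive_iff less_top)
qed

lemma enn2real_prod: "enn2real (\<Prod>k\<in>J. f k) = (\<Prod>k\<in>J. enn2real (f k))"
  by (induction J rule: infinite_finite_induct) (simp_all add: enn2real_mult)

lemma mutually_ac_sym: "mutually_ac S s n P Q \<Longrightarrow> mutually_ac S s n Q P"
  by (auto simp: mutually_ac_def)

lemma AE_lik_ratio_pos:
  assumes P: "prob_space P" "sets P = sets (path_space S s)"
    and Q: "prob_space Q" "sets Q = sets (path_space S s)"
    and ac: "mutually_ac S s n P Q"
  shows "AE x in law_on S s n Q. 0 < lik_ratio S s n P Q x"
  unfolding lik_ratio_def
  by (rule AE_RN_deriv_pos_finite)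
    (use ac in \<open>auto simp: mutually_ac_def prob_space_law_on P Q sets_law_on[OF P(2)] sets_law_on[OF Q(2)]\<close>)

lemma AE_law_on_mutually_ac:
  assumes "sets P = sets (path_space S s)" "sets Q = sets (path_space S s)"
    and "mutually_ac S s n P Q" "AE x in law_on S s n Q. R x"
  shows "AE x in law_on S s n P. R x"
  by (rule absolutely_continuous_AE[OF _ _ assms(4)])
    (use assms in \<open>auto simp: mutually_ac_def sets_law_on\<close>)

text \<open>
  Exchanging \<open>q\<close> and \<open>r\<close> gives the converse continuity: products of equivalent marginals are
  equivalent.
\<close>

lemma mutually_ac_product_law:
  assumes q: "source_laws K S q" and r: "source_laws K S r"
    and ac: "\<And>k. k \<in> {1..K} \<Longrightarrow> mutually_ac S {k} n (q k) (r k)"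
  shows product_law_density: "law_on S {1..K} n (product_law K S q) =
      density (law_on S {1..K} n (product_law K S r))
        (\<lambda>x. \<Prod>k\<in>{1..K}. RN_deriv (law_on S {k} n (r k)) (law_on S {k} n (q k)) (restrict x {k}))"
      (is ?dens)
    and product_density_measurable: "(\<lambda>x. \<Prod>k\<in>{1..K}. RN_deriv (law_on S {k} n (r k)) (law_on S {k} n (q k)) (restrict x {k}))
      \<in> borel_measurable (obs_sigma S {1..K} n)" (is ?meas)
    and product_law_ac: "absolutely_continuous (law_on S {1..K} n (product_law K S r)) (law_on S {1..K} n (product_law K S q))" (is ?ac)
proof -
  let ?\<phi> = "\<lambda>k. RN_deriv (law_on S {k} n (r k)) (law_on S {k} n (q k))"
  have \<phi>: "?\<phi> k \<in> borel_measurable (obs_sigma S {k} n)"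
    and d: "law_on S {k} n (q k) = density (law_on S {k} n (r k)) (?\<phi> k)"
    if k: "k \<in> {1..K}" for k
  proof -
    have q': "prob_space (q k)" "sets (q k) = sets (path_space S {k})"
      and r': "prob_space (r k)" "sets (r k) = sets (path_space S {k})"
      using q r k by (auto simp: source_laws_def)
    have "?\<phi> k \<in> borel_measurable (law_on S {k} n (r k))" by simp
    then show "?\<phi> k \<in> borel_measurable (obs_sigma S {k} n)"
      by (simp only: measurable_cong_sets[OF sets_law_on[OF r'(2)] refl])
    interpret prob_space "law_on S {k} n (r k)" by (rule prob_space_law_on[OF r'])
    show "law_on S {k} n (q k) = density (law_on S {k} n (r k)) (?\<phi> k)"
      by (rule density_RN_deriv[symmetric])
        (use ac[OF k] in \<open>auto simp: mutually_ac_def sets_law_on[OF r'(2)] sets_law_on[OF q'(2)]\<close>)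
  qed
  show ?meas using law_on_product_law_density(1)[OF q r \<phi> d] by simp
  show ?dens using law_on_product_law_density(2)[OF q r \<phi> d] by simp
  then show ?ac
    using absolutely_continuousI_density[OF measurable_law_on[OF sets_product_law \<open>?meas\<close>]] by simp
qed

text \<open>
  The chain rule through \<open>product_law K S r\<close>. Its likelihood ratio against \<open>Q\<close> is the factor that does
  not depend on \<open>q\<close>. Only \<open>q\<close> is compared with \<open>Q\<close> directly; the comparison of \<open>r\<close> with \<open>Q\<close> follows,
  because the two products are equivalent.
\<close>

lemma AE_lik_ratio_product:
  assumes q: "source_laws K S q" and r: "source_laws K S r"
    and ac: "\<And>k. k \<in> {1..K} \<Longrightarrow> mutually_ac S {k} n (q k) (r k)"
    and Q: "prob_space Q" "sets Q = sets (path_space S {1..K})"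
    and acQ: "mutually_ac S {1..K} n (product_law K S q) Q"
  shows "AE x in law_on S {1..K} n Q. lik_ratio S {1..K} n (product_law K S q) Q x =
      lik_ratio S {1..K} n (product_law K S r) Q x *
        (\<Prod>k\<in>{1..K}. lik_ratio S {k} n (q k) (r k) (restrict x {k}))"
    and "mutually_ac S {1..K} n (product_law K S r) Q"
proof -
  let ?law = "law_on S {1..K} n"
  let ?\<Phi> = "\<lambda>x. \<Prod>k\<in>{1..K}. RN_deriv (law_on S {k} n (r k)) (law_on S {k} n (q k)) (restrict x {k})"
  have ac': "mutually_ac S {k} n (r k) (q k)" if "k \<in> {1..K}" for k
    using ac[OF that] by (rule mutually_ac_sym)
  have trans: "absolutely_continuous M2 M3 \<Longrightarrow> absolutely_continuous M1 M2 \<Longrightarrow> absolutely_continuous M1 M3"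
    for M1 M2 M3 :: "(nat \<Rightarrow> nat \<Rightarrow> 'a) measure"
    by (auto simp: absolutely_continuous_def)
  show acR: "mutually_ac S {1..K} n (product_law K S r) Q"
    using acQ product_law_ac[OF q r ac] product_law_ac[OF r q ac'] trans
    unfolding mutually_ac_def by blast
  interpret Q: prob_space "?law Q" by (rule prob_space_law_on[OF Q])
  \<comment> \<open>Stacking the two densities and using uniqueness of the Radon-Nikodym derivative.\<close>
  let ?c = "RN_deriv (?law Q) (?law (product_law K S r))"
  have R: "?law (product_law K S r) = density (?law Q) ?c"
    using acR by (intro Q.density_RN_deriv[symmetric])
      (simp_all only: mutually_ac_def sets_law_on[OF Q(2)] sets_law_on[OF sets_product_law])
  have \<Phi>: "?\<Phi> \<in> borel_measurable (?law Q)"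
    by (rule measurable_law_on[OF Q(2) product_density_measurable[OF q r ac]])
  have "density (?law Q) (\<lambda>x. ?c x * ?\<Phi> x) = density (density (?law Q) ?c) ?\<Phi>"
    using \<Phi> by (intro density_density_eq[symmetric]) simp_all
  also have "\<dots> = ?law (product_law K S q)"
    unfolding R[symmetric] by (rule product_law_density[OF q r ac, symmetric])
  finally have "AE x in ?law Q. ?c x * ?\<Phi> x = RN_deriv (?law Q) (?law (product_law K S q)) x"
    using \<Phi> by (intro Q.RN_deriv_unique) auto
  then show "AE x in ?law Q. lik_ratio S {1..K} n (product_law K S q) Q x =
      lik_ratio S {1..K} n (product_law K S r) Q x *
        (\<Prod>k\<in>{1..K}. lik_ratio S {k} n (q k) (r k) (restrict x {k}))"
    by eventually_elim (simp add: lik_ratio_def flip: enn2real_prod enn2real_mult)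
qed

lemma measurable_restrict_path_space:
  assumes "t \<subseteq> s" "sets P = sets (path_space S s)"
  shows "(\<lambda>x. restrict x t) \<in> P \<rightarrow>\<^sub>M path_space S t"
  using measurable_restrict_subset[OF assms(1), of "source_space S"]
  by (simp add: path_space_def measurable_cong_sets[OF assms(2)[unfolded path_space_def] refl])

lemma sub_law_all:
  assumes "sets P = sets (path_space S s)"
  shows "sub_law S s P = P"
proof -
  have "sub_law S s P = distr P P (\<lambda>x. x)"
    unfolding sub_law_def
  proof (rule distr_cong)
    fix x assume "x \<in> space P"
    then have "x \<in> space (path_space S s)" using sets_eq_imp_space_eq[OF assms] by simp
    then show "restrict x s = x" by (auto simp: path_space_def space_PiM PiE_iff extensional_restrict)
  qed (simp_all add: assms)
  then show ?thesis by (simp add: distr_id)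
qed

section \<open>Isolation statistics in terms of local statistics\<close>

context
  fixes K l u :: nat
    and S :: "nat \<Rightarrow> nat \<Rightarrow> 'a measure"
    and \<P> :: "(nat \<Rightarrow> nat \<Rightarrow> 'a) measure set"
    and H G :: "nat \<Rightarrow> (nat \<Rightarrow> nat \<Rightarrow> 'a) measure set"
    and P0' :: "(nat \<Rightarrow> nat \<Rightarrow> 'a) measure"
    and P0 :: "nat \<Rightarrow> (nat \<Rightarrow> nat \<Rightarrow> 'a) measure"
  assumes hyps: "hypotheses_setup K S \<P> H G"
    and standing: "standing_assumptions K S \<P> H G (Psi_between K l u)"
    and indep: "\<forall>P \<in> P_Psi K S \<P> H G (Psi_between K l u). independent_sources K S P"
    and combinations: "all_local_combinations K S \<P> H G (Psi_between K l u)"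
    and l: "1 \<le> l" "l \<le> u" "l < K"
    and P0': "P0' \<in> H_null K S \<P> H"
    and P0: "\<forall>k\<in>{1..K}. P0 k \<in> sub_law S {k} ` H_null K S \<P> H"
begin

abbreviation (input) "admissible_sets \<equiv> Psi_between K l u"
abbreviation (input) "admissible_laws \<equiv> P_Psi K S \<P> H G admissible_sets"
abbreviation (input) "null_laws \<equiv> H_null K S \<P> H"

lemma finite_family: "finite \<P>"
  and family_law: "P \<in> \<P> \<Longrightarrow> prob_space P" "P \<in> \<P> \<Longrightarrow> sets P = sets (path_space S {1..K})"
  and local_family: "k \<in> {1..K} \<Longrightarrow> H k \<union> G k \<subseteq> sub_law S {k} ` \<P>"
    "k \<in> {1..K} \<Longrightarrow> H k \<noteq> {}" "k \<in> {1..K} \<Longrightarrow> G k \<noteq> {}" "k \<in> {1..K} \<Longrightarrow> H k \<inter> G k = {}"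
  using hyps unfolding hypotheses_setup_def by auto

lemma sub_law_prob:
  assumes "P \<in> \<P>" "k \<in> {1..K}"
  shows "prob_space (sub_law S {k} P)" "sets (sub_law S {k} P) = sets (path_space S {k})"
proof -
  have "(\<lambda>x. restrict x {k}) \<in> P \<rightarrow>\<^sub>M path_space S {k}"
    using assms family_law by (intro measurable_restrict_path_space[of _ "{1..K}"]) auto
  then show "prob_space (sub_law S {k} P)"
    unfolding sub_law_def by (rule prob_space.prob_space_distr[OF family_law(1)[OF assms(1)]])
  show "sets (sub_law S {k} P) = sets (path_space S {k})" by (simp add: sub_law_def)
qed

lemma P_Psi_local:
  assumes "P \<in> admissible_laws"
  shows "P \<in> \<P>" "signals K S G P \<in> admissible_sets"
    "k \<in> {1..K} \<Longrightarrow> sub_law S {k} P \<in> (if k \<in> signals K S G P then G k else H k)"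
  using assms by (auto simp: P_Psi_def signals_def)

text \<open>
  The laws of \<open>P_Psi\<close> are as plentiful as possible: this is what makes the maxima over laws
  factorise.
\<close>

lemma ex_law_with_local_laws:
  assumes A: "A \<in> admissible_sets" and q: "\<And>k. k \<in> {1..K} \<Longrightarrow> q k \<in> (if k \<in> A then G k else H k)"
  shows "\<exists>P\<in>admissible_laws. (\<forall>k\<in>{1..K}. sub_law S {k} P = q k) \<and> signals K S G P = A"
proof -
  have sub: "A \<subseteq> {1..K}" using A by (simp add: Psi_between_def)
  have iff: "q k \<in> G k \<longleftrightarrow> k \<in> A" if "k \<in> {1..K}" for k
    using q[OF that] local_family(4)[OF that] by (auto split: if_splits)
  then have sig: "{k\<in>{1..K}. q k \<in> G k} = A" using sub by auto
  have HG: "\<forall>k\<in>{1..K}. q k \<in> H k \<union> G k" using q by (metis UnI1 UnI2)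
  then obtain P where P: "P \<in> \<P>" "\<forall>k\<in>{1..K}. sub_law S {k} P = q k"
    using combinations[unfolded all_local_combinations_def, rule_format, of q] HG sig A by auto
  have "signals K S G P = A" using P sig unfolding signals_def by auto
  moreover have "P \<in> admissible_laws" using P HG A \<open>signals K S G P = A\<close> by (simp add: P_Psi_def)
  ultimately show ?thesis using P by auto
qed

text \<open>
  As \<open>l \<ge> 1\<close>, every admissible law has a signal and so lies outside the global null.
\<close>

lemma H_Psi_eq: "H_Psi K S \<P> H G admissible_sets k = {P\<in>admissible_laws. k \<notin> signals K S G P}"
proof -
  have "P \<notin> null_laws" if "P \<in> admissible_laws" for P
  proof
    assume "P \<in> null_laws"
    then have "signals K S G P = {}"
      using local_family(4) by (fastforce simp: H_null_def signals_def)
    then show False using P_Psi_local(2)[OF that] l by (simp add: Psi_between_def)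
  qed
  then show ?thesis by (auto simp: H_Psi_def)
qed

text \<open>
  Both maxima in the isolation statistic range over nonempty sets of laws because
  \<open>1 \<le> l \<le> u\<close> and \<open>l < K\<close>.
\<close>

lemma ex_admissible_set:
  assumes "k \<in> {1..K}"
  shows "\<exists>A\<in>admissible_sets. k \<in> A" "\<exists>A\<in>admissible_sets. k \<notin> A"
proof -
  have c: "card ({1..K} - {k}) = K - 1" using assms by simp
  have "l - 1 \<le> card ({1..K} - {k})" using c l by linarith
  then obtain A where A: "A \<subseteq> {1..K} - {k}" "card A = l - 1" "finite A"
    by (rule obtain_subset_with_card_n)
  have "card (insert k A) = l" using A l by (subst card_insert_disjoint) auto
  then have "insert k A \<in> admissible_sets" using A assms l by (auto simp: Psi_between_def)
  then show "\<exists>A\<in>admissible_sets. k \<in> A" by blast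
  have "l \<le> card ({1..K} - {k})" using c l by linarith
  then obtain A' where "A' \<subseteq> {1..K} - {k}" "card A' = l" "finite A'"
    by (rule obtain_subset_with_card_n)
  then have "A' \<in> admissible_sets" "k \<notin> A'" using l by (auto simp: Psi_between_def)
  then show "\<exists>A\<in>admissible_sets. k \<notin> A" by blast
qed

lemma ex_law_with_local_law:
  assumes "k \<in> {1..K}" "A \<in> admissible_sets" "q \<in> (if k \<in> A then G k else H k)"
  shows "\<exists>P\<in>admissible_laws. sub_law S {k} P = q \<and> signals K S G P = A"
proof -
  have "\<forall>j\<in>{1..K}. \<exists>r. r \<in> (if j \<in> A then G j else H j) \<and> (j = k \<longrightarrow> r = q)"
    using local_family(2,3) assms(3) by (metis (full_types) equals0I)
  then obtain r where r: "\<forall>j\<in>{1..K}. r j \<in> (if j \<in> A then G j else H j) \<and> (j = k \<longrightarrow> r j = q)"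
    using bchoice by metis
  then show ?thesis using ex_law_with_local_laws[OF assms(2), of r] assms(1) by metis
qed

lemma standing_ac:
  assumes "k \<in> {1..K}" "P \<in> G_Psi K S \<P> H G admissible_sets k \<union> null_laws" "Q \<in> H_Psi K S \<P> H G admissible_sets k \<union> null_laws"
    "k \<in> s" "s \<subseteq> {1..K}" "1 \<le> n"
  shows "mutually_ac S s n (sub_law S s P) (sub_law S s Q)"
proof -
  have "\<forall>k\<in>{1..K}. \<forall>P \<in> G_Psi K S \<P> H G admissible_sets k \<union> null_laws.
      \<forall>Q \<in> H_Psi K S \<P> H G admissible_sets k \<union> null_laws. \<forall>s. k \<in> s \<and> s \<subseteq> {1..K} \<longrightarrow>
        (\<forall>n\<ge>1. mutually_ac S s n (sub_law S s P) (sub_law S s Q))"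
    using standing unfolding standing_assumptions_def by (rule conjunct1)
  then show ?thesis using assms by blast
qed

text \<open>
  A local alternative is the marginal of a law in \<open>G_Psi\<close> and a local null law that of a law in
  \<open>H_Psi\<close>, so the standing assumptions compare either with the marginals of the global null.
\<close>

lemma local_ac:
  assumes k: "k \<in> {1..K}" and q: "q \<in> H k \<union> G k" and n: "1 \<le> n"
  shows "mutually_ac S {k} n q (P0 k)"
proof -
  obtain N where N: "N \<in> null_laws" "P0 k = sub_law S {k} N" using bspec[OF P0 k] by auto
  from q show ?thesis
  proof
    assume "q \<in> G k"
    moreover obtain A where "A \<in> admissible_sets" "k \<in> A" using ex_admissible_set(1)[OF k] by auto
    ultimately obtain P where P: "P \<in> admissible_laws" "sub_law S {k} P = q" "k \<in> signals K S G P"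
      using ex_law_with_local_law[OF k, of A q] by auto
    then have "P \<in> G_Psi K S \<P> H G admissible_sets k" by (simp add: G_Psi_def)
    then show ?thesis using standing_ac[OF k, of P N "{k}" n] N P(2) n k by simp
  next
    assume "q \<in> H k"
    moreover obtain A where "A \<in> admissible_sets" "k \<notin> A" using ex_admissible_set(2)[OF k] by auto
    ultimately obtain P where P: "P \<in> admissible_laws" "sub_law S {k} P = q" "k \<notin> signals K S G P"
      using ex_law_with_local_law[OF k, of A q] by auto
    then have "P \<in> H_Psi K S \<P> H G admissible_sets k" by (simp add: H_Psi_eq)
    then have "mutually_ac S {k} n (P0 k) q"
      using standing_ac[OF k, of N P "{k}" n] N P(2) n k by simp
    then show ?thesis by (rule mutually_ac_sym)
  qed
qed

lemma global_ac:
  assumes P: "P \<in> admissible_laws \<union> null_laws" and n: "1 \<le> n"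
  shows "mutually_ac S {1..K} n P P0'"
proof -
  have fam: "P \<in> \<P>" "P0' \<in> \<P>" using P P0' by (auto simp: P_Psi_def H_null_def)
  have "\<exists>k\<in>{1..K}. P \<in> G_Psi K S \<P> H G admissible_sets k \<union> null_laws"
  proof (cases "P \<in> null_laws")
    case True
    then show ?thesis using l by auto
  next
    case False
    then have "P \<in> admissible_laws" using P by simp
    moreover from P_Psi_local(2)[OF this] have "signals K S G P \<noteq> {}" "signals K S G P \<subseteq> {1..K}"
      using l by (auto simp: Psi_between_def)
    ultimately show ?thesis by (auto simp: G_Psi_def)
  qed
  then obtain k where "k \<in> {1..K}" "P \<in> G_Psi K S \<P> H G admissible_sets k \<union> null_laws" by auto
  then have "mutually_ac S {1..K} n (sub_law S {1..K} P) (sub_law S {1..K} P0')"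
    using P0' n by (intro standing_ac[where k = k]) auto
  then show ?thesis using sub_law_all[of P S "{1..K}"] sub_law_all[of P0' S "{1..K}"] fam family_law(2) by simp
qed

text \<open>
  The reference law \<open>product_law K S P0\<close> is equivalent to \<open>P0'\<close> on the first \<open>n\<close> observations, being
  equivalent to an admissible law.
\<close>

lemma AE_global_lik_ratio:
  assumes n: "1 \<le> n"
  shows "AE x in law_on S {1..K} n P0'. \<exists>c>0. \<forall>P\<in>admissible_laws. lik_ratio S {1..K} n P P0' x =
    c * (\<Prod>k\<in>{1..K}. lik_ratio S {k} n (sub_law S {k} P) (P0 k) (restrict x {k}))"
proof -
  have Q: "prob_space P0'" "sets P0' = sets (path_space S {1..K})"
    using P0' family_law by (auto simp: H_null_def)
  have r: "source_laws K S P0"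
    unfolding source_laws_def using P0 sub_law_prob by (fastforce simp: H_null_def)
  have q: "source_laws K S (\<lambda>k. sub_law S {k} P)"
    and acq: "\<And>k. k \<in> {1..K} \<Longrightarrow> mutually_ac S {k} n (sub_law S {k} P) (P0 k)"
    and eq: "product_law K S (\<lambda>k. sub_law S {k} P) = P"
    and acQ: "mutually_ac S {1..K} n (product_law K S (\<lambda>k. sub_law S {k} P)) P0'"
    if P: "P \<in> admissible_laws" for P
  proof -
    show "source_laws K S (\<lambda>k. sub_law S {k} P)"
      unfolding source_laws_def using sub_law_prob P_Psi_local(1)[OF P] by auto
    show "mutually_ac S {k} n (sub_law S {k} P) (P0 k)" if "k \<in> {1..K}" for k
      using P_Psi_local(3)[OF P that] by (intro local_ac that n) (auto split: if_splits)
    show eq: "product_law K S (\<lambda>k. sub_law S {k} P) = P"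
      using bspec[OF indep P] unfolding independent_sources_def product_law_def by (rule sym)
    show "mutually_ac S {1..K} n (product_law K S (\<lambda>k. sub_law S {k} P)) P0'"
      unfolding eq using P n by (intro global_ac) auto
  qed
  have one: "1 \<in> {1..K}" using l by simp
  obtain A where "A \<in> admissible_sets" "1 \<in> A" using ex_admissible_set(1)[OF one] by blast
  moreover obtain g where "g \<in> G 1" using local_family(3)[OF one] by blast
  ultimately obtain P where "P \<in> admissible_laws"
    using ex_law_with_local_law[OF one, of A g] by auto
  then have "mutually_ac S {1..K} n (product_law K S P0) P0'"
    using AE_lik_ratio_product(2)[OF q r acq Q acQ] by blast
  then have "AE x in law_on S {1..K} n P0'. 0 < lik_ratio S {1..K} n (product_law K S P0) P0' x"
    by (intro AE_lik_ratio_pos prob_space_product_law r Q sets_product_law)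
  moreover have "AE x in law_on S {1..K} n P0'. \<forall>P\<in>admissible_laws. lik_ratio S {1..K} n P P0' x =
      lik_ratio S {1..K} n (product_law K S P0) P0' x *
      (\<Prod>k\<in>{1..K}. lik_ratio S {k} n (sub_law S {k} P) (P0 k) (restrict x {k}))"
  proof (rule AE_finite_allI)
    show "finite admissible_laws" using finite_family by (simp add: P_Psi_def)
    fix P assume P: "P \<in> admissible_laws"
    show "AE x in law_on S {1..K} n P0'. lik_ratio S {1..K} n P P0' x =
      lik_ratio S {1..K} n (product_law K S P0) P0' x *
      (\<Prod>k\<in>{1..K}. lik_ratio S {k} n (sub_law S {k} P) (P0 k) (restrict x {k}))"
      using AE_lik_ratio_product(1)[OF q[OF P] r acq[OF P] Q acQ[OF P]] by (simp only: eq[OF P])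
  qed
  ultimately show ?thesis by eventually_elim blast
qed

lemma AE_local_lik_ratio_pos:
  assumes P: "P \<in> admissible_laws \<union> null_laws" and k: "k \<in> {1..K}" and q: "q \<in> H k \<union> G k" and n: "1 \<le> n"
  shows "AE x in P. 0 < lik_ratio S {k} n q (P0 k) (restrict x {k})"
proof -
  have fam: "P \<in> \<P>" using P by (auto simp: P_Psi_def H_null_def)
  have loc: "sub_law S {k} P \<in> H k \<union> G k"
    using P P_Psi_local(3)[of P k] k by (auto simp: H_null_def split: if_splits)
  have qlaw: "prob_space q" "sets q = sets (path_space S {k})"
    using q local_family(1)[OF k] sub_law_prob k by auto
  have P0law: "prob_space (P0 k)" "sets (P0 k) = sets (path_space S {k})"
    using bspec[OF P0 k] k sub_law_prob by (auto simp: H_null_def)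
  have "AE y in law_on S {k} n (P0 k). 0 < lik_ratio S {k} n q (P0 k) y"
    by (intro AE_lik_ratio_pos qlaw P0law local_ac k q n)
  then have "AE y in law_on S {k} n (sub_law S {k} P). 0 < lik_ratio S {k} n q (P0 k) y"
    by (rule AE_law_on_mutually_ac[OF sub_law_prob(2)[OF fam k] P0law(2) local_ac[OF k loc n]])
  then have "AE y in sub_law S {k} P. 0 < lik_ratio S {k} n q (P0 k) y"
    by (rule AE_law_onD[OF sub_law_prob(2)[OF fam k]])
  moreover have "(\<lambda>x. restrict x {k}) \<in> P \<rightarrow>\<^sub>M path_space S {k}"
    using k family_law(2)[OF fam] by (intro measurable_restrict_path_space[of _ "{1..K}"]) auto
  ultimately show ?thesis unfolding sub_law_def by (rule AE_distrD[rotated])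
qed

text \<open>
  Both maxima carry the same two factors, the common factor \<open>c\<close> of the laws and the product of the
  local maxima over the null laws, which therefore cancel.
\<close>

lemma iso_stat_eq_iso_ratio:
  assumes k: "k \<in> {1..K}" and c: "c > 0"
    and factor: "\<And>P. P \<in> admissible_laws \<Longrightarrow> lik_ratio S {1..K} n P P0' x =
      c * (\<Prod>k\<in>{1..K}. lik_ratio S {k} n (sub_law S {k} P) (P0 k) (restrict x {k}))"
    and pos: "\<And>k q. k \<in> {1..K} \<Longrightarrow> q \<in> H k \<union> G k \<Longrightarrow> 0 < lik_ratio S {k} n q (P0 k) (restrict x {k})"
  shows "iso_stat K S \<P> H G admissible_sets P0' x n k = iso_ratio admissible_sets (local_stat S H G P0 x n) k"
    and "local_stat S H G P0 x n k > 0"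
proof -
  let ?lam = "\<lambda>k q. lik_ratio S {k} n q (P0 k) (restrict x {k})"
  have HG: "finite (H j) \<and> H j \<noteq> {} \<and> finite (G j) \<and> G j \<noteq> {}" if "j \<in> {1..K}" for j
    using local_family(1-3)[OF that] finite_family by (meson Un_subset_iff finite_imageI finite_subset)
  have Max: "Max ((\<lambda>P. lik_ratio S {1..K} n P P0' x) ` {P\<in>admissible_laws. R (signals K S G P)}) =
    c * (\<Prod>j\<in>{1..K}. Max (?lam j ` H j)) * Max (prod (local_stat S H G P0 x n) ` {A\<in>admissible_sets. R A})"
    if R: "\<exists>A\<in>admissible_sets. R A" for R
    unfolding local_stat_def[abs_def]
  proof (rule Max_prod_choice[where m = "\<lambda>P k. sub_law S {k} P"])
    show "finite {P\<in>admissible_laws. R (signals K S G P)}" using finite_family by (simp add: P_Psi_def)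
    show "finite {A\<in>admissible_sets. R A}" using finite_Psi_between by simp
    show "{A\<in>admissible_sets. R A} \<noteq> {}" using R by auto
    show "A \<subseteq> {1..K}" if "A \<in> {A\<in>admissible_sets. R A}" for A using that by (auto simp: Psi_between_def)
    show "\<exists>A\<in>{A\<in>admissible_sets. R A}. \<forall>j\<in>{1..K}. sub_law S {j} P \<in> (if j \<in> A then G j else H j)"
      if "P \<in> {P\<in>admissible_laws. R (signals K S G P)}" for P
      using that P_Psi_local(2,3)[of P] by (intro bexI[of _ "signals K S G P"]) auto
    show "\<exists>P\<in>{P\<in>admissible_laws. R (signals K S G P)}. \<forall>j\<in>{1..K}. sub_law S {j} P = q j"
      if "A \<in> {A\<in>admissible_sets. R A}" "\<And>j. j \<in> {1..K} \<Longrightarrow> q j \<in> (if j \<in> A then G j else H j)" for A q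
      using that ex_law_with_local_laws[of A q] by auto
  qed (use HG pos c factor in auto)
  have hpos: "(\<Prod>j\<in>{1..K}. Max (?lam j ` H j)) > 0"
    using HG pos by (intro prod_pos) (simp add: Max_gr_iff, blast)
  have ne: "c * (\<Prod>j\<in>{1..K}. Max (?lam j ` H j)) \<noteq> 0"
    using mult_pos_pos[OF c hpos] by (rule less_imp_neq[THEN not_sym])
  have "iso_stat K S \<P> H G admissible_sets P0' x n k =
    Max ((\<lambda>P. lik_ratio S {1..K} n P P0' x) ` {P\<in>admissible_laws. k \<in> signals K S G P}) /
    Max ((\<lambda>P. lik_ratio S {1..K} n P P0' x) ` {P\<in>admissible_laws. k \<notin> signals K S G P})"
    by (simp add: iso_stat_def H_Psi_eq G_Psi_def)
  also have "\<dots> = iso_ratio admissible_sets (local_stat S H G P0 x n) k"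
    by (simp only: Max[OF ex_admissible_set(1)[OF k]] Max[OF ex_admissible_set(2)[OF k]]
        iso_ratio_def mult_divide_mult_cancel_left[OF ne])
  finally show "iso_stat K S \<P> H G admissible_sets P0' x n k = iso_ratio admissible_sets (local_stat S H G P0 x n) k" .
  have "Max (?lam k ` G k) > 0" "Max (?lam k ` H k) > 0"
    using HG[OF k] pos[OF k] by (simp add: Max_gr_iff, blast)+
  then show "local_stat S H G P0 x n k > 0" by (simp add: local_stat_def)
qed

text \<open>
  Times and laws are countably many, so one null set serves for all of them.
\<close>

lemma AE_iso_stat_eq_iso_ratio:
  assumes P: "P \<in> admissible_laws \<union> null_laws"
  shows "AE x in P. \<forall>n\<ge>1. \<forall>k\<in>{1..K}. local_stat S H G P0 x n k > 0 \<and>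
    iso_stat K S \<P> H G admissible_sets P0' x n k = iso_ratio admissible_sets (local_stat S H G P0 x n) k"
proof -
  have fam: "P \<in> \<P>" "P0' \<in> \<P>" using P P0' by (auto simp: P_Psi_def H_null_def)
  have "AE x in P. 1 \<le> n \<longrightarrow> (\<forall>k\<in>{1..K}. local_stat S H G P0 x n k > 0 \<and>
    iso_stat K S \<P> H G admissible_sets P0' x n k = iso_ratio admissible_sets (local_stat S H G P0 x n) k)" for n
  proof (cases "1 \<le> n")
    case n: True
    have "AE x in P. \<exists>c>0. \<forall>P\<in>admissible_laws. lik_ratio S {1..K} n P P0' x =
      c * (\<Prod>k\<in>{1..K}. lik_ratio S {k} n (sub_law S {k} P) (P0 k) (restrict x {k}))"
      by (rule AE_law_onD[OF family_law(2)[OF fam(1)]],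
          rule AE_law_on_mutually_ac[OF family_law(2)[OF fam(1)] family_law(2)[OF fam(2)]
            global_ac[OF P n] AE_global_lik_ratio[OF n]])
    moreover have "AE x in P. \<forall>k\<in>{1..K}. \<forall>q\<in>H k \<union> G k.
        0 < lik_ratio S {k} n q (P0 k) (restrict x {k})"
    proof (intro AE_finite_allI)
      fix k assume k: "k \<in> {1..K}"
      show "finite (H k \<union> G k)" using local_family(1)[OF k] finite_family finite_subset by blast
      show "AE x in P. 0 < lik_ratio S {k} n q (P0 k) (restrict x {k})" if "q \<in> H k \<union> G k" for q
        by (rule AE_local_lik_ratio_pos[OF P k that n])
    qed simp
    ultimately show ?thesis
    proof eventually_elim
      case (elim x)
      then obtain c where "c > 0" "\<forall>P\<in>admissible_laws. lik_ratio S {1..K} n P P0' x =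
        c * (\<Prod>k\<in>{1..K}. lik_ratio S {k} n (sub_law S {k} P) (P0 k) (restrict x {k}))" by blast
      then show ?case using iso_stat_eq_iso_ratio[of _ c n x] elim(2) by blast
    qed
  qed simp
  then show ?thesis by (subst AE_all_countable) simp
qed

lemma AE_T_star:
  assumes P: "P \<in> admissible_laws \<union> null_laws" and AB: "A > 1" "B > 1"
    and E: "\<And>L. (\<And>k. k \<in> {1..K} \<Longrightarrow> L k > 0) \<Longrightarrow> stops K admissible_sets A B (iso_ratio admissible_sets L) \<longleftrightarrow> E L"
  shows "AE x in P. T_star K admissible_sets A B (iso_stat K S \<P> H G admissible_sets P0' x) =
    first_time (\<lambda>n. E (local_stat S H G P0 x n))"
  using AE_iso_stat_eq_iso_ratio[OF P]
proof eventually_elim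
  case (elim x)
  have "stops K admissible_sets A B (iso_stat K S \<P> H G admissible_sets P0' x n) \<longleftrightarrow> E (local_stat S H G P0 x n)"
    if "1 \<le> n" for n
  proof -
    have e: "\<forall>k\<in>{1..K}. local_stat S H G P0 x n k > 0"
      "\<forall>k\<in>{1..K}. iso_stat K S \<P> H G admissible_sets P0' x n k = iso_ratio admissible_sets (local_stat S H G P0 x n) k"
      using elim that by blast+
    have "stops K admissible_sets A B (iso_stat K S \<P> H G admissible_sets P0' x n) \<longleftrightarrow>
        stops K admissible_sets A B (iso_ratio admissible_sets (local_stat S H G P0 x n))"
      unfolding stops_def using e(2) by (simp cong: conj_cong)
    also have "\<dots> \<longleftrightarrow> E (local_stat S H G P0 x n)" by (rule E) (use e(1) in blast)
    finally show ?thesis .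
  qed
  then show ?case unfolding T_star_def stops_def by (rule first_time_cong)
qed

end

section \<open>The stopping time\<close>

theorem theorem5p2:
  fixes K l u :: nat and A B :: real
    and S :: "nat \<Rightarrow> nat \<Rightarrow> 'a measure"
    and \<P> :: "(nat \<Rightarrow> nat \<Rightarrow> 'a) measure set"
    and H G :: "nat \<Rightarrow> (nat \<Rightarrow> nat \<Rightarrow> 'a) measure set"
    and P0' :: "(nat \<Rightarrow> nat \<Rightarrow> 'a) measure"
    and P0 :: "nat \<Rightarrow> (nat \<Rightarrow> nat \<Rightarrow> 'a) measure"
  defines "\<Psi> \<equiv> Psi_between K l u"
  defines "Iso \<equiv> iso_stat K S \<P> H G \<Psi> P0'"
  defines "Loc \<equiv> local_stat S H G P0"
  assumes hyps: "hypotheses_setup K S \<P> H G"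
    and standing: "standing_assumptions K S \<P> H G \<Psi>"
    and indep: "\<forall>P \<in> P_Psi K S \<P> H G \<Psi>. independent_sources K S P"
    and combinations: "all_local_combinations K S \<P> H G \<Psi>"
    and l: "l \<ge> 1"
    and thresholds: "A > 1" "B > 1"
    and P0': "P0' \<in> H_null K S \<P> H"
    and P0: "\<forall>k\<in>{1..K}. P0 k \<in> sub_law S {k} ` H_null K S \<P> H"
  shows "(l = u \<and> u < K \<longrightarrow>
      (\<forall>P \<in> P_Psi K S \<P> H G \<Psi> \<union> H_null K S \<P> H. AE x in P.
         T_star K \<Psi> A B (Iso x) =
         first_time (\<lambda>n. ordered K (Loc x n) u \<ge> ordered K (Loc x n) (u + 1) * max A B)))
    \<and> (l < u \<and> u < K \<longrightarrow>
      (\<forall>P \<in> P_Psi K S \<P> H G \<Psi> \<union> H_null K S \<P> H. AE x in P.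
         T_star K \<Psi> A B (Iso x) =
         Min {T1 K l A B (Loc x), T2 K l A B (Loc x), T4 K l u A B (Loc x),
              T5 K u A B (Loc x), T6 K u A B (Loc x)}))
    \<and> (l < u \<and> u = K \<longrightarrow>
      (\<forall>P \<in> P_Psi K S \<P> H G \<Psi> \<union> H_null K S \<P> H. AE x in P.
         T_star K \<Psi> A B (Iso x) =
         Min {T1 K l A B (Loc x), T2 K l A B (Loc x), T3 K l A B (Loc x)}))"
proof (intro conjI impI ballI; elim conjE)
  fix P assume P: "P \<in> P_Psi K S \<P> H G \<Psi> \<union> H_null K S \<P> H"
  have AE: "AE x in P. T_star K \<Psi> A B (Iso x) = first_time (\<lambda>n. E (Loc x n))"
    if "l \<le> u" "l < K"
      "\<And>L. (\<And>k. k \<in> {1..K} \<Longrightarrow> L k > 0) \<Longrightarrow> stops K \<Psi> A B (iso_ratio \<Psi> L) \<longleftrightarrow> E L" for E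
    unfolding Iso_def Loc_def \<Psi>_def
    by (rule AE_T_star[OF hyps standing[unfolded \<Psi>_def] indep[unfolded \<Psi>_def]
      combinations[unfolded \<Psi>_def] l that(1,2) P0' P0 P[unfolded \<Psi>_def] thresholds
      that(3)[unfolded \<Psi>_def]])
  note iff = stops_iff_ordered[OF thresholds l, of K _ u, folded \<Psi>_def]
  { assume lu: "l = u" "u < K"
    show "AE x in P. T_star K \<Psi> A B (Iso x) =
        first_time (\<lambda>n. ordered K (Loc x n) u \<ge> ordered K (Loc x n) (u + 1) * max A B)"
      by (rule AE[where E = "\<lambda>L. ordered K L u \<ge> ordered K L (u + 1) * max A B"])
        (use lu iff(1) in auto) }
  { assume lu: "l < u" "u < K"
    have "AE x in P. T_star K \<Psi> A B (Iso x) = first_time (\<lambda>n.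
      (num_above K (Loc x n) < l \<and> ordered K (Loc x n) l \<ge> ordered K (Loc x n) (l + 1) * max A B) \<or>
      (num_above K (Loc x n) = l \<and>
        ordered K (Loc x n) (l + 1) \<le> min (1/A) (ordered K (Loc x n) l / B)) \<or>
      (l < num_above K (Loc x n) \<and> num_above K (Loc x n) < u \<and>
        (\<forall>k\<in>{1..K}. Loc x n k \<notin> {1/A<..<B})) \<or>
      (num_above K (Loc x n) = u \<and>
        ordered K (Loc x n) u \<ge> max B (A * ordered K (Loc x n) (u + 1))) \<or>
      (num_above K (Loc x n) > u \<and>
        ordered K (Loc x n) u \<ge> ordered K (Loc x n) (u + 1) * max A B))"
      by (rule AE[where E = "\<lambda>L.
        (num_above K L < l \<and> ordered K L l \<ge> ordered K L (l + 1) * max A B) \<or>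
        (num_above K L = l \<and> ordered K L (l + 1) \<le> min (1/A) (ordered K L l / B)) \<or>
        (l < num_above K L \<and> num_above K L < u \<and> (\<forall>k\<in>{1..K}. L k \<notin> {1/A<..<B})) \<or>
        (num_above K L = u \<and> ordered K L u \<ge> max B (A * ordered K L (u + 1))) \<or>
        (num_above K L > u \<and> ordered K L u \<ge> ordered K L (u + 1) * max A B)"])
        (use lu iff(2) in auto)
    then show "AE x in P. T_star K \<Psi> A B (Iso x) =
         Min {T1 K l A B (Loc x), T2 K l A B (Loc x), T4 K l u A B (Loc x),
              T5 K u A B (Loc x), T6 K u A B (Loc x)}"
      unfolding first_time_disj by (simp add: T1_def T2_def T4_def T5_def T6_def) }
  { assume lu: "l < u" "u = K"
    have "AE x in P. T_star K \<Psi> A B (Iso x) = first_time (\<lambda>n.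
      (num_above K (Loc x n) < l \<and> ordered K (Loc x n) l \<ge> ordered K (Loc x n) (l + 1) * max A B) \<or>
      (num_above K (Loc x n) = l \<and>
        ordered K (Loc x n) (l + 1) \<le> min (1/A) (ordered K (Loc x n) l / B)) \<or>
      (num_above K (Loc x n) > l \<and> (\<forall>k\<in>{1..K}. Loc x n k \<notin> {1/A<..<B})))"
      by (rule AE[where E = "\<lambda>L.
        (num_above K L < l \<and> ordered K L l \<ge> ordered K L (l + 1) * max A B) \<or>
        (num_above K L = l \<and> ordered K L (l + 1) \<le> min (1/A) (ordered K L l / B)) \<or>
        (num_above K L > l \<and> (\<forall>k\<in>{1..K}. L k \<notin> {1/A<..<B}))"])
        (use lu iff(3) in auto)
    then show "AE x in P. T_star K \<Psi> A B (Iso x) =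
         Min {T1 K l A B (Loc x), T2 K l A B (Loc x), T3 K l A B (Loc x)}"
      unfolding first_time_disj by (simp add: T1_def T2_def T3_def) }
qed

end
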